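(* Let $G$ be a finite connected graph with universal cover $T$, and let $\lambda_1(G)$ be the largest eigenvalue of its adjacency matrix. Then $\lambda_1(G) = \rho(T)$ if and only if $G$ has at most one cycle, and this holds if and only if the average degree of $G$ is at most $2$.
   Context: Graphs may have multiple edges and loops; a loop contributes $2$ to the degree of its vertex, and a loop or a pair of parallel edges counts as a cycle. The universal cover of a connected graph $G$ is the tree $T$ admitting a surjective graph homomorphism $\pi: T\to G$ that restricts to a bijection from the 1-neighbourhood (star) of each vertex $\hat v$ of $T$ onto that of $\pi(\hat v)$ in $G$. $\rho(T)$ is the operator norm of the adjacency operator of $T$ acting on $\ell^2(V(T))$. *)

theory Defs
  imports "HOL-Analysis.Analysis" "Graph_Theory.Graph_Theory"
begin

text \<open>
  A graph with loops and multiple edges is a bidirected digraph \<open>G\<close> with arc reversal \<open>r\<close>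
  (a graph in the sense of Serre): an undirected edge is a pair \<open>{a, r a}\<close> of mutually
  reverse arcs, and \<open>r\<close> has no fixed points on the arcs. In particular a loop consists of
  two arcs, both leaving its vertex, so that \<^const>\<open>out_degree\<close> is the degree in which a loop
  counts twice, and \<^const>\<open>out_arcs\<close> is the star of a vertex.
\<close>

definition average_degree :: "('v, 'e) pre_digraph \<Rightarrow> real" where
  "average_degree G = (\<Sum>v\<in>verts G. real (out_degree G v)) / real (card (verts G))"

text \<open>
  Cycles are subgraphs, represented by their sets of undirected edges. The library's
  \<^const>\<open>pre_digraph.cycle\<close> is a closed walk without repeated vertices; this also admits
  \<open>[a, r a]\<close>, going back and forth along one edge, which is excluded here (and which makes the
  library's \<^const>\<open>tree\<close> unsuitable for bidirected digraphs). Loops and pairs of parallel edges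
  are cycles.
\<close>

definition cycles :: "('v, 'e) pre_digraph \<Rightarrow> ('e \<Rightarrow> 'e) \<Rightarrow> 'e set set set" where
  "cycles G r = {(\<lambda>a. {a, r a}) ` set p | p.
     pre_digraph.cycle G p \<and> (\<forall>a\<in>set p. r a \<notin> set p)}"

definition at_most_one_cycle :: "('v, 'e) pre_digraph \<Rightarrow> ('e \<Rightarrow> 'e) \<Rightarrow> bool" where
  "at_most_one_cycle G r \<longleftrightarrow> (\<forall>C\<in>cycles G r. \<forall>D\<in>cycles G r. C = D)"

definition is_tree :: "('v, 'e) pre_digraph \<Rightarrow> ('e \<Rightarrow> 'e) \<Rightarrow> bool" where
  "is_tree G r \<longleftrightarrow> bidirected_digraph G r \<and> Digraph_Component.connected G \<and> cycles G r = {}"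

definition graph_hom ::
  "('w, 'f) pre_digraph \<Rightarrow> ('f \<Rightarrow> 'f) \<Rightarrow> ('v, 'e) pre_digraph \<Rightarrow> ('e \<Rightarrow> 'e) \<Rightarrow>
   ('w \<Rightarrow> 'v) \<Rightarrow> ('f \<Rightarrow> 'e) \<Rightarrow> bool" where
  "graph_hom H s G r \<pi>v \<pi>e \<longleftrightarrow>
     (\<forall>v\<in>verts H. \<pi>v v \<in> verts G) \<and>
     (\<forall>a\<in>arcs H. \<pi>e a \<in> arcs G \<and> tail G (\<pi>e a) = \<pi>v (tail H a) \<and>
        head G (\<pi>e a) = \<pi>v (head H a) \<and> \<pi>e (s a) = r (\<pi>e a))"

definition is_universal_cover ::
  "('w, 'f) pre_digraph \<Rightarrow> ('f \<Rightarrow> 'f) \<Rightarrow> ('v, 'e) pre_digraph \<Rightarrow> ('e \<Rightarrow> 'e) \<Rightarrow> bool" where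
  "is_universal_cover T s G r \<longleftrightarrow> is_tree T s \<and>
     (\<exists>\<pi>v \<pi>e. graph_hom T s G r \<pi>v \<pi>e \<and>
        \<pi>v ` verts T = verts G \<and> \<pi>e ` arcs T = arcs G \<and>
        (\<forall>v\<in>verts T. bij_betw \<pi>e (out_arcs T v) (out_arcs G (\<pi>v v))))"

text \<open>The diagonal entry at \<open>v\<close> is twice the number of loops at \<open>v\<close>.\<close>

definition adjacency_matrix :: "('v, 'e) pre_digraph \<Rightarrow> 'v \<Rightarrow> 'v \<Rightarrow> real" where
  "adjacency_matrix G u v = real (card {a \<in> arcs G. tail G a = u \<and> head G a = v})"

definition matrix_eigenvalues :: "'v set \<Rightarrow> ('v \<Rightarrow> 'v \<Rightarrow> real) \<Rightarrow> real set" where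
  "matrix_eigenvalues V A = {c. \<exists>x. (\<exists>v\<in>V. x v \<noteq> 0) \<and>
     (\<forall>u\<in>V. (\<Sum>v\<in>V. A u v * x v) = c * x u)}"

definition lambda1 :: "('v, 'e) pre_digraph \<Rightarrow> real" where
  "lambda1 G = Max (matrix_eigenvalues (verts G) (adjacency_matrix G))"

definition ell2 :: "'v set \<Rightarrow> ('v \<Rightarrow> complex) set" where
  "ell2 V = {f. (\<lambda>v. (cmod (f v))\<^sup>2) summable_on V}"

definition ell2_norm :: "'v set \<Rightarrow> ('v \<Rightarrow> complex) \<Rightarrow> real" where
  "ell2_norm V f = sqrt (\<Sum>\<^sub>\<infinity>v\<in>V. (cmod (f v))\<^sup>2)"

definition adjacency_op :: "('v, 'e) pre_digraph \<Rightarrow> ('v \<Rightarrow> complex) \<Rightarrow> 'v \<Rightarrow> complex" where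
  "adjacency_op G f v = (\<Sum>a\<in>out_arcs G v. f (head G a))"

text \<open>
  The operator norm on \<open>\<ell>\<^sup>2\<close> of the vertex set. It is used for graphs of bounded degree only,
  where \<^const>\<open>adjacency_op\<close> maps \<^const>\<open>ell2\<close> to itself and the supremum is finite.
\<close>

definition rho :: "('v, 'e) pre_digraph \<Rightarrow> real" where
  "rho G = (SUP f\<in>{f \<in> ell2 (verts G). ell2_norm (verts G) f \<le> 1}.
     ell2_norm (verts G) (adjacency_op G f))"

end

theory Submission
  imports Defs
begin

text \<open>
  Let \<open>x\<close> be the Perron eigenvector of \<open>G\<close>, \<open>y\<close> its lift to \<open>T\<close>, and \<open>\<lambda>\<close> the eigenvalue. The Schur
  test bounds the norm of the adjacency operator by \<open>K\<close> as soon as there are arc weights \<open>c > 0\<close>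
  with \<open>c a * c (s a) = 1\<close> whose sum over every star is at most \<open>K\<close>; the weights
  \<open>y (head a) / y (tail a)\<close> give \<open>rho T \<le> \<lambda>\<close>.

  If all cycles of \<open>G\<close> pass through one edge, count signed crossings of its lifts along paths from a
  root of \<open>T\<close>. A vertex of \<open>T\<close> is determined by its projection and this height, so the set of
  vertices with height in \<open>{-n..n}\<close> is finite with at most two boundary arcs; the restrictions of
  \<open>y\<close> to these sets have Rayleigh quotients tending to \<open>\<lambda>\<close>.

  If \<open>G\<close> has more edges than vertices, there is a function \<open>\<theta>\<close> on arcs with
  \<open>\<theta> a + \<theta> (r a)\<close> and the star sums of \<open>\<theta>\<close> both constant, the former smaller than the latter: this
  is a flow with prescribed divergence of total zero, which exists on a connected graph. Perturbing
  the weights \<open>x (head a) / x (tail a)\<close> by \<open>\<theta>\<close>, with opposite effect on arcs of \<open>T\<close> towards and away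
  from a root, makes all star sums smaller than \<open>\<lambda>\<close>, so \<open>rho T < \<lambda>\<close>.

  Finally, if \<open>G\<close> has two cycles, deleting an edge of each leaves it connected, so it has more edges
  than vertices.
\<close>

section \<open>Reduced walks\<close>

context bidirected_digraph begin

definition reduced :: "'b awalk \<Rightarrow> bool" where
  "reduced = successively (\<lambda>a b. b \<noteq> arev a)"

lemma reduced_Nil [simp]: "reduced []"
  by (simp add: reduced_def)

lemma reduced_append_iff:
  "reduced (p @ q) \<longleftrightarrow>
     reduced p \<and> reduced q \<and> (p = [] \<or> q = [] \<or> hd q \<noteq> arev (last p))"
  by (auto simp: reduced_def successively_append_iff)

lemma reduced_Cons_iff: "reduced (a # p) \<longleftrightarrow> p = [] \<or> hd p \<noteq> arev a \<and> reduced p"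
  by (auto simp: reduced_def successively_Cons)

text \<open>If the heads are distinct, the walk itself is a cycle: an arc and a later reversal of it
  would have to be adjacent, against reducedness. Otherwise a repeated head cuts out a shorter
  reduced closed walk. The last arc may be the reverse of the first one.\<close>

lemma reduced_closed_awalk_contains_cycle:
  assumes "awalk u p u" "reduced p" "p \<noteq> []"
  shows "\<exists>q. cycle q \<and> set q \<subseteq> set p \<and> (\<forall>a\<in>set q. arev a \<notin> set q)"
  using assms
proof (induction "length p" arbitrary: p u rule: less_induct)
  case less
  have arcs: "set p \<subseteq> arcs G" and cas: "cas u p u"
    using less.prems(1) by auto
  show ?case
  proof (cases "distinct (map (head G) p)")
    case True
    have "cycle p"
      unfolding cycle_def
      using less.prems True awalk_verts_conv'[OF cas] by auto
    have consecutive: "tail G (p ! Suc i) = head G (p ! i)" if "Suc i < length p" for i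
    proof -
      have "p = take i p @ p ! i # p ! Suc i # drop (Suc (Suc i)) p"
        using that by (simp add: Cons_nth_drop_Suc)
      then have "awalk u (take i p @ p ! i # p ! Suc i # drop (Suc (Suc i)) p) u"
        using less.prems(1) by simp
      then show ?thesis by (simp add: awalk_Cons_iff)
    qed
    have no_rev: "p ! j \<noteq> arev (p ! i)" if "i < j" "j < length p" for i j
    proof
      assume eq: "p ! j = arev (p ! i)"
      obtain k where j: "j = Suc k" using \<open>i < j\<close> by (cases j) auto
      have "p ! i \<in> arcs G" using arcs that by auto
      then have "head G (p ! k) = head G (p ! i)"
        using consecutive[of k] eq j that(2) by simp
      then have "k = i"
        using nth_eq_iff_index_eq[OF True, of k i] that j by simp
      then have "p ! Suc i \<noteq> arev (p ! i)"
        using less.prems(2) that j by (auto simp: reduced_def dest: successively_nth)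
      then show False using eq j \<open>k = i\<close> by simp
    qed
    have "arev a \<notin> set p" if a: "a \<in> set p" for a
    proof
      assume "arev a \<in> set p"
      then obtain j where "j < length p" "p ! j = arev a" by (meson in_set_conv_nth)
      moreover obtain i where "i < length p" "p ! i = a" using a by (meson in_set_conv_nth)
      moreover have "arev a \<noteq> a" using that arcs by (auto dest: arev_neq)
      ultimately show False
        using no_rev[of i j] no_rev[of j i] by (cases i j rule: linorder_cases) auto
    qed
    then show ?thesis using \<open>cycle p\<close> by blast
  next
    case False
    then obtain xs ys zs y where "map (head G) p = xs @ [y] @ ys @ [y] @ zs"
      using not_distinct_decomp by blast
    then obtain p1 e1 p2 e2 p3 where p: "p = p1 @ e1 # p2 @ e2 # p3"
      and y: "head G e1 = y" "head G e2 = y"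
      by (auto simp: map_eq_append_conv map_eq_Cons_conv append_eq_map_conv Cons_eq_map_conv)
    have "awalk y (p2 @ [e2]) y"
      using less.prems(1) p y by (auto simp: awalk_simps intro: head_in_verts)
    moreover have "reduced (p2 @ [e2])"
      using less.prems(2) unfolding p
      by (auto simp: reduced_append_iff reduced_Cons_iff)
    moreover have "length (p2 @ [e2]) < length p" using p by simp
    ultimately obtain q where "cycle q" "set q \<subseteq> set (p2 @ [e2])"
      "\<forall>a\<in>set q. arev a \<notin> set q"
      using less.hyps[of "p2 @ [e2]" y] by blast
    then show ?thesis using p by auto
  qed
qed

lemma apath_imp_reduced:
  assumes "apath u p v"
  shows "reduced p"
  using assms
proof (induction p arbitrary: u)
  case (Cons a p)
  show ?case
  proof (cases p)
    case (Cons b q)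
    then have "b \<noteq> arev a"
      using Cons.prems by (cases q) (auto simp: apath_Cons_iff)
    then show ?thesis
      using Cons Cons.prems Cons.IH[of "head G a"]
      by (auto simp: apath_Cons_iff reduced_Cons_iff)
  qed (simp add: reduced_Cons_iff)
qed simp

lemma awalk_reverse:
  assumes "awalk u p v"
  shows "awalk v (rev (map arev p)) u"
  using assms
proof (induction p arbitrary: u)
  case (Cons a p)
  then have "a \<in> arcs G" "u = tail G a" "awalk v (rev (map arev p)) (head G a)"
    by (auto simp: awalk_Cons_iff)
  then show ?case by (auto simp: awalk_simps)
qed (simp add: awalk_Nil_iff)

lemma reduced_reverse:
  assumes "reduced p"
  shows "reduced (rev (map arev p))"
  using assms unfolding reduced_def
  by (auto simp: successively_map elim: successively_mono)

text \<open>Induction on the last arc. Equal last arcs are removed; if they differ, \<open>p\<close>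
  followed by the reversal of \<open>q\<close> is reduced and closed, so it would contain a
  cycle.\<close>

lemma reduced_awalk_unique:
  assumes acyclic: "cycles G arev = {}"
    and "awalk u p v" "reduced p" "awalk u q v" "reduced q"
  shows "p = q"
  using assms(2-)
proof (induction p arbitrary: q v rule: rev_induct)
  have no_closed: "p = []" if "awalk w p w" "reduced p" for w p
    using reduced_closed_awalk_contains_cycle[OF that] acyclic
    unfolding cycles_def by blast
  {
    case Nil
    then show ?case using no_closed by (auto simp: awalk_Nil_iff)
  next
    case (snoc a p)
    show ?case
    proof (cases q rule: rev_cases)
      case Nil
      then have "u = v" using snoc.prems(3) by (simp add: awalk_Nil_iff)
      then show ?thesis using no_closed[OF _ snoc.prems(2)] snoc.prems(1) by blast
    next
      case (snoc q' b)
      show ?thesis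
      proof (cases "a = b")
        case True
        have "awalk u p (tail G a)" "awalk u q' (tail G a)"
          using snoc snoc.prems True by (auto simp: awalk_simps)
        then have "p = q'"
          using snoc.IH snoc snoc.prems by (simp add: reduced_append_iff)
        then show ?thesis using True snoc by simp
      next
        case False
        have ab: "a \<in> arcs G" "b \<in> arcs G"
          using snoc snoc.prems by (auto simp: awalk_simps)
        have "awalk u ((p @ [a]) @ rev (map arev q)) u"
          using snoc.prems awalk_reverse by (meson awalk_appendI)
        moreover have "reduced ((p @ [a]) @ rev (map arev q))"
        proof -
          have "hd (rev (map arev q)) = arev b" using snoc by simp
          then show ?thesis
            using False snoc.prems reduced_reverse[of q]
            unfolding reduced_append_iff[of "p @ [a]" "rev (map arev q)"]
            by (simp add: arev_eq_iff)
        qed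
        ultimately show ?thesis using no_closed by blast
      qed
    qed
  }
qed

end

section \<open>Counting edges\<close>

lemma rtrancl_crossing:
  assumes "(x, y) \<in> R\<^sup>*" "x \<in> U" "y \<notin> U"
  shows "\<exists>u v. (u, v) \<in> R \<and> u \<in> U \<and> v \<notin> U"
  using assms by (induction rule: rtrancl_induct) auto

context bidirected_digraph begin

text \<open>Connectedness of the spanning subgraph with arc set \<open>A\<close>, phrased on arc
  sets so that edges can be deleted while the digraph stays fixed.\<close>

definition connected_by :: "'b set \<Rightarrow> bool" where
  "connected_by A \<longleftrightarrow> verts G \<times> verts G \<subseteq> ((\<lambda>a. (tail G a, head G a)) ` A)\<^sup>*"

lemma awalk_imp_rtrancl:
  assumes "awalk u p v" "set p \<subseteq> A"
  shows "(u, v) \<in> ((\<lambda>a. (tail G a, head G a)) ` A)\<^sup>*"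
  using assms
proof (induction p arbitrary: u)
  case (Cons a p)
  then have "(tail G a, head G a) \<in> (\<lambda>a. (tail G a, head G a)) ` A" "u = tail G a"
    "(head G a, v) \<in> ((\<lambda>a. (tail G a, head G a)) ` A)\<^sup>*"
    by (auto simp: awalk_Cons_iff)
  then show ?case by (metis converse_rtrancl_into_rtrancl)
qed (simp add: awalk_Nil_iff)

lemma connected_imp_apath:
  assumes "Digraph_Component.connected G" "u \<in> verts G" "v \<in> verts G"
  shows "\<exists>p. apath u p v"
proof -
  have "strongly_connected G"
    using symmetric_connected_imp_strongly_connected[OF sym_arcs assms(1)] .
  then show ?thesis
    using assms(2,3) unfolding strongly_connected_def reachable_apath by blast
qed

lemma connected_by_arcs:
  assumes "Digraph_Component.connected G"
  shows "connected_by (arcs G)"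
proof -
  have "(u, v) \<in> ((\<lambda>a. (tail G a, head G a)) ` arcs G)\<^sup>*" if uv: "u \<in> verts G" "v \<in> verts G" for u v
  proof -
    obtain p where "awalk u p v"
      using connected_imp_apath[OF assms uv] by (blast dest: awalkI_apath)
    then show ?thesis by (rule awalk_imp_rtrancl) (use \<open>awalk u p v\<close> in blast)
  qed
  then show ?thesis by (auto simp: connected_by_def)
qed

text \<open>A spanning tree is grown from \<open>v0\<close>: each new vertex brings in a crossing
  arc and its reverse, so the \<open>k + 1\<close> vertices reached so far have at least
  \<open>2 * k\<close> arcs of \<open>A\<close> among them.\<close>

lemma card_verts_le_card_connecting_arcs:
  assumes "finite (verts G)" "finite A" "A \<subseteq> arcs G" "arev ` A \<subseteq> A" "connected_by A"
  shows "2 * card (verts G) \<le> card A + 2"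
proof (cases "verts G = {}")
  case False
  then obtain v0 where v0: "v0 \<in> verts G" by blast
  let ?inner = "\<lambda>U. {a \<in> A. tail G a \<in> U \<and> head G a \<in> U}"
  have claim: "\<exists>U\<subseteq>verts G. v0 \<in> U \<and> card U = Suc k \<and> 2 * k \<le> card (?inner U)"
    if "Suc k \<le> card (verts G)" for k
    using that
  proof (induction k)
    case 0
    then show ?case using v0 by (intro exI[of _ "{v0}"]) auto
  next
    case (Suc k)
    then obtain U where U: "U \<subseteq> verts G" "v0 \<in> U" "card U = Suc k"
      "2 * k \<le> card (?inner U)"
      by auto
    have "U \<noteq> verts G" using U(3) Suc.prems by auto
    then obtain w where "w \<in> verts G" "w \<notin> U" using U(1) by blast
    moreover have "(v0, w) \<in> ((\<lambda>a. (tail G a, head G a)) ` A)\<^sup>*"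
      using assms(5) v0 \<open>w \<in> verts G\<close> by (auto simp: connected_by_def)
    ultimately have "\<exists>x y. (x, y) \<in> (\<lambda>a. (tail G a, head G a)) ` A \<and> x \<in> U \<and> y \<notin> U"
      using rtrancl_crossing[of v0 w _ U] U(2) by simp
    then obtain a where a: "a \<in> A" "tail G a \<in> U" "head G a \<notin> U" by auto
    then have arc: "a \<in> arcs G" using assms(3) by blast
    let ?U = "insert (head G a) U"
    have "card ({a, arev a} \<union> ?inner U) \<le> card (?inner ?U)"
      using a arc assms(2,4) by (intro card_mono) auto
    moreover have "card ({a, arev a} \<union> ?inner U) = 2 + card (?inner U)"
      using a arc assms(2) arev_neq[OF arc] by (subst card_Un_disjoint) auto
    moreover have "card ?U = Suc (Suc k)"
      using U a finite_subset[OF U(1) assms(1)] by simp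
    ultimately show ?case
      using U arc by (intro exI[of _ ?U]) auto
  qed
  have "card (verts G) > 0" using v0 assms(1) by (auto simp: card_gt_0_iff)
  then obtain U where "2 * (card (verts G) - 1) \<le> card (?inner U)"
    using claim[of "card (verts G) - 1"] by auto
  also have "\<dots> \<le> card A" using assms(2) by (intro card_mono) auto
  finally show ?thesis by simp
qed simp

text \<open>The rest of the cycle is a detour between the ends of \<open>a\<close>. It avoids
  \<open>a\<close> and \<open>arev a\<close> because \<open>q\<close> repeats no arc and contains no
  arc together with its reverse.\<close>

lemma connected_by_delete_cycle_edge:
  assumes "connected_by A" "A \<subseteq> arcs G" "arev ` A \<subseteq> A"
    and q: "cycle q" "set q \<subseteq> A" "\<forall>b\<in>set q. arev b \<notin> set q" and "a \<in> set q"
  shows "connected_by (A - {a, arev a})"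
proof -
  let ?e = "\<lambda>a. (tail G a, head G a)"
  let ?B = "A - {a, arev a}"
  obtain u where u: "awalk u q u" and dist: "distinct q"
    using q(1) unfolding cycle_conv by blast
  obtain q1 q2 where split: "q = q1 @ a # q2" using \<open>a \<in> set q\<close> by (auto dest: split_list)
  have a: "a \<in> arcs G" using \<open>a \<in> set q\<close> q(2) assms(2) by blast
  have "awalk (head G a) (q2 @ q1) (tail G a)"
    using u unfolding split by (auto simp: awalk_Cons_iff)
  moreover have "set (q2 @ q1) \<subseteq> ?B"
    using dist q(2,3) unfolding split by auto
  ultimately have "(head G a, tail G a) \<in> (?e ` ?B)\<^sup>*"
    by (rule awalk_imp_rtrancl)
  moreover have "sym (?e ` ?B)"
  proof (rule symI)
    fix x y assume "(x, y) \<in> ?e ` ?B"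
    then obtain b where b: "b \<in> ?B" "x = tail G b" "y = head G b" by blast
    moreover have "arev b \<in> ?B" using b assms(3) by (auto simp: arev_eq_iff)
    moreover have "b \<in> arcs G" using b assms(2) by blast
    ultimately show "(y, x) \<in> ?e ` ?B" by (intro image_eqI[of _ _ "arev b"]) auto
  qed
  ultimately have ha: "(head G a, tail G a) \<in> (?e ` ?B)\<^sup>*" "(tail G a, head G a) \<in> (?e ` ?B)\<^sup>*"
    by (simp_all add: symD[OF sym_rtrancl])
  have "?e ` A \<subseteq> (?e ` ?B)\<^sup>*"
  proof
    fix x assume "x \<in> ?e ` A"
    then obtain b where b: "b \<in> A" "x = ?e b" by blast
    show "x \<in> (?e ` ?B)\<^sup>*"
      using b ha a by (cases "b \<in> {a, arev a}") auto
  qed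
  then have "(?e ` A)\<^sup>* \<subseteq> (?e ` ?B)\<^sup>*"
    by (metis rtrancl_idemp rtrancl_mono)
  then show ?thesis using assms(1) by (auto simp: connected_by_def)
qed

text \<open>The edge deleted first lies on \<open>p\<close> but not on \<open>q\<close>, so
  \<open>q\<close> survives and one of its edges can be deleted next. What remains still connects
  all vertices and thus has at least \<open>2 * card (verts G) - 2\<close> arcs; four arcs were
  removed.\<close>

lemma card_arcs_ge_if_two_cycles:
  assumes "fin_digraph G" "Digraph_Component.connected G" "\<not> at_most_one_cycle G arev"
  shows "2 * card (verts G) + 2 \<le> card (arcs G)"
proof -
  interpret fin_digraph G by fact
  let ?E = "\<lambda>p. (\<lambda>a. {a, arev a}) ` set p"
  \<comment> \<open>Of two different edge sets one is not contained in the other; \<open>p\<close>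
    names the cycle with the extra edge.\<close>
  have "\<exists>p q. cycle p \<and> (\<forall>a\<in>set p. arev a \<notin> set p) \<and> cycle q \<and> (\<forall>a\<in>set q. arev a \<notin> set q) \<and>
      \<not> ?E p \<subseteq> ?E q"
    using assms(3) unfolding at_most_one_cycle_def cycles_def by blast
  then obtain p q where p: "cycle p" "\<forall>a\<in>set p. arev a \<notin> set p"
    and q: "cycle q" "\<forall>a\<in>set q. arev a \<notin> set q" and "\<not> ?E p \<subseteq> ?E q"
    by blast
  then obtain a where a: "a \<in> set p" "{a, arev a} \<notin> ?E q" by blast
  obtain b where b: "b \<in> set q" using q(1) by (cases q) (auto simp: cycle_def)
  have arcs: "set p \<subseteq> arcs G" "set q \<subseteq> arcs G"
    using p(1) q(1) by (auto simp: cycle_def)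
  let ?A = "arcs G - {a, arev a}"
  let ?B = "?A - {b, arev b}"
  have closed: "arev ` (X - {c, arev c}) \<subseteq> X - {c, arev c}" if "arev ` X \<subseteq> X" for X c
    using that by (auto simp: arev_eq_iff)
  have "arev a \<notin> set q"
    using a(2) image_eqI[of "{a, arev a}" "\<lambda>a. {a, arev a}" "arev a" "set q"]
    by (auto simp: insert_commute)
  moreover have "a \<notin> set q" using a(2) by blast
  ultimately have "set q \<subseteq> ?A" using arcs(2) by blast
  then have "b \<in> ?A" using b by blast
  have "arev ` arcs G \<subseteq> arcs G" by auto
  have "connected_by ?A"
    using \<open>arev ` arcs G \<subseteq> arcs G\<close> connected_by_delete_cycle_edge[OF connected_by_arcs[OF assms(2)] _ _ p(1) arcs(1) p(2) a(1)]
    by auto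
  then have "connected_by ?B"
    using connected_by_delete_cycle_edge[OF _ _ _ q(1) \<open>set q \<subseteq> ?A\<close> q(2) b]
      closed[OF \<open>arev ` arcs G \<subseteq> arcs G\<close>]
    by blast
  then have *: "2 * card (verts G) \<le> card ?B + 2"
    using closed[OF closed[OF \<open>arev ` arcs G \<subseteq> arcs G\<close>], of b a]
    by (intro card_verts_le_card_connecting_arcs) auto
  have **: "card {a, arev a} = 2" "card {b, arev b} = 2"
    using a(1) b arcs arev_neq[of a] arev_neq[of b] by (auto simp: card_insert_if)
  have "{a, arev a} \<subseteq> arcs G" "{b, arev b} \<subseteq> ?A"
    using a(1) arcs \<open>b \<in> ?A\<close> by (auto simp: arev_eq_iff)
  then have "card ?B = card ?A - card {b, arev b}" "card ?A = card (arcs G) - card {a, arev a}"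
    by (simp_all only: card_Diff_subset finite.emptyI finite_insert)
  moreover have "card {b, arev b} \<le> card ?A" "card {a, arev a} \<le> card (arcs G)"
    using card_mono[OF finite_Diff[OF finite_arcs] \<open>{b, arev b} \<subseteq> ?A\<close>]
      card_mono[OF finite_arcs \<open>{a, arev a} \<subseteq> arcs G\<close>] by (simp_all only:)
  ultimately show ?thesis using * ** by linarith
qed

end

section \<open>Flows\<close>

lemma (in fin_digraph) sum_out_arcs:
  "(\<Sum>v\<in>verts G. \<Sum>a\<in>out_arcs G v. f a) = (\<Sum>a\<in>arcs G. f a)"
  unfolding out_arcs_def by (rule sum.group) auto

lemma (in fin_digraph) average_degree_conv:
  "average_degree G = card (arcs G) / card (verts G)"
proof -
  have "(\<Sum>v\<in>verts G. real (out_degree G v)) = (\<Sum>v\<in>verts G. \<Sum>a\<in>out_arcs G v. 1)"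
    by (simp add: out_degree_def)
  also have "\<dots> = card (arcs G)"
    by (subst sum_out_arcs) simp
  finally show ?thesis by (simp add: average_degree_def)
qed

context bidirected_digraph begin

text \<open>One unit is sent along the walk. Every arc of the walk adds 1 to itself and -1 to its
  reverse, and the contributions at intermediate vertices cancel.\<close>

lemma exists_flow_of_dipole:
  assumes "fin_digraph G" "awalk u p v"
  shows "\<exists>\<eta>::'b \<Rightarrow> real. (\<forall>a\<in>arcs G. \<eta> (arev a) = - \<eta> a) \<and>
    (\<forall>w\<in>verts G. (\<Sum>a\<in>out_arcs G w. \<eta> a) = of_bool (w = u) - of_bool (w = v))"
  using assms(2)
proof (induction p arbitrary: u)
  case Nil
  then show ?case by (intro exI[of _ "\<lambda>_. 0"]) (auto simp: awalk_Nil_iff)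
next
  interpret fin_digraph G by fact
  case (Cons b p)
  then have b: "b \<in> arcs G" "u = tail G b" and "awalk (head G b) p v"
    by (auto simp: awalk_Cons_iff)
  then obtain \<eta> :: "'b \<Rightarrow> real" where \<eta>: "\<forall>a\<in>arcs G. \<eta> (arev a) = - \<eta> a"
    "\<forall>w\<in>verts G. (\<Sum>a\<in>out_arcs G w. \<eta> a) = of_bool (w = head G b) - of_bool (w = v)"
    using Cons.IH[OF \<open>awalk (head G b) p v\<close>] by blast
  let ?\<eta> = "\<lambda>a. \<eta> a + (of_bool (a = b) - of_bool (a = arev b))"
  have "?\<eta> (arev a) = - ?\<eta> a" if "a \<in> arcs G" for a
  proof -
    have "arev a = b \<longleftrightarrow> a = arev b" by auto
    then show ?thesis using \<eta>(1) that by (simp add: arev_eq_iff)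
  qed
  moreover have "(\<Sum>a\<in>out_arcs G w. ?\<eta> a) = of_bool (w = u) - of_bool (w = v)"
    if "w \<in> verts G" for w
  proof -
    have "finite (out_arcs G w)" by blast
    moreover have "b \<in> out_arcs G w \<longleftrightarrow> w = u" "arev b \<in> out_arcs G w \<longleftrightarrow> w = head G b"
      using b by auto
    ultimately have "(\<Sum>a\<in>out_arcs G w. of_bool (a = b) - of_bool (a = arev b) :: real) =
        of_bool (w = u) - of_bool (w = head G b)"
      by (simp add: sum_subtractf of_bool_def)
    then show ?thesis using \<eta>(2) that by (simp add: sum.distrib)
  qed
  ultimately show ?case by (intro exI[of _ ?\<eta>]) auto
qed

text \<open>Superposition of dipoles from each \<open>v\<close> to a fixed \<open>v0\<close>, with
  coefficient \<open>d v\<close>. The sinks at \<open>v0\<close> add up to the total of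
  \<open>d\<close>, which is zero.\<close>

lemma exists_flow:
  fixes d :: "'a \<Rightarrow> real"
  assumes "fin_digraph G" "Digraph_Component.connected G" "(\<Sum>v\<in>verts G. d v) = 0"
  shows "\<exists>\<eta>. (\<forall>a\<in>arcs G. \<eta> (arev a) = - \<eta> a) \<and>
    (\<forall>w\<in>verts G. (\<Sum>a\<in>out_arcs G w. \<eta> a) = d w)"
proof -
  interpret fin_digraph G by fact
  obtain v0 where v0: "v0 \<in> verts G" using assms(2) by (auto simp: connected_conv)
  have "\<forall>v\<in>verts G. \<exists>\<eta>::'b \<Rightarrow> real. (\<forall>a\<in>arcs G. \<eta> (arev a) = - \<eta> a) \<and>
      (\<forall>w\<in>verts G. (\<Sum>a\<in>out_arcs G w. \<eta> a) = of_bool (w = v) - of_bool (w = v0))"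
  proof
    fix v assume "v \<in> verts G"
    then obtain p where "awalk v p v0"
      using connected_imp_apath[OF assms(2) _ v0] by (blast dest: awalkI_apath)
    then show "\<exists>\<eta>::'b \<Rightarrow> real. (\<forall>a\<in>arcs G. \<eta> (arev a) = - \<eta> a) \<and>
        (\<forall>w\<in>verts G. (\<Sum>a\<in>out_arcs G w. \<eta> a) = of_bool (w = v) - of_bool (w = v0))"
      by (rule exists_flow_of_dipole[OF assms(1)])
  qed
  then have "\<exists>\<eta>::'a \<Rightarrow> 'b \<Rightarrow> real. \<forall>v\<in>verts G. (\<forall>a\<in>arcs G. \<eta> v (arev a) = - \<eta> v a) \<and>
      (\<forall>w\<in>verts G. (\<Sum>a\<in>out_arcs G w. \<eta> v a) = of_bool (w = v) - of_bool (w = v0))"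
    by (rule bchoice)
  then obtain \<eta> :: "'a \<Rightarrow> 'b \<Rightarrow> real" where \<eta>:
    "\<And>v a. v \<in> verts G \<Longrightarrow> a \<in> arcs G \<Longrightarrow> \<eta> v (arev a) = - \<eta> v a"
    "\<And>v w. v \<in> verts G \<Longrightarrow> w \<in> verts G \<Longrightarrow>
       (\<Sum>a\<in>out_arcs G w. \<eta> v a) = of_bool (w = v) - of_bool (w = v0)"
    by auto
  let ?\<eta> = "\<lambda>a. \<Sum>v\<in>verts G. d v * \<eta> v a"
  have "?\<eta> (arev a) = - ?\<eta> a" if "a \<in> arcs G" for a
    using \<eta>(1) that by (simp add: sum_negf)
  moreover have "(\<Sum>a\<in>out_arcs G w. ?\<eta> a) = d w" if "w \<in> verts G" for w
  proof -
    have "(\<Sum>a\<in>out_arcs G w. ?\<eta> a) = (\<Sum>v\<in>verts G. d v * (\<Sum>a\<in>out_arcs G w. \<eta> v a))"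
      by (subst sum.swap) (simp add: sum_distrib_left)
    also have "\<dots> = (\<Sum>v\<in>verts G. (if w = v then d v else 0) - d v * of_bool (w = v0))"
      using \<eta>(2) that by (intro sum.cong) (auto simp: right_diff_distrib)
    also have "\<dots> = d w - (\<Sum>v\<in>verts G. d v) * of_bool (w = v0)"
      unfolding sum_subtractf sum_distrib_right[symmetric] using that by simp
    also have "\<dots> = d w" using assms(3) by simp
    finally show ?thesis .
  qed
  ultimately show ?thesis by (intro exI[of _ ?\<eta>]) auto
qed

end

section \<open>Perron eigenvectors\<close>

text \<open>The first-order condition at a maximum, in algebraic form: \<open>t = s * e\<close>
  turns the expression into \<open>s * e\<^sup>2 * (2 + s * c)\<close>, and \<open>s\<close> is
  small enough to make the last factor positive.\<close>

lemma quadratic_nonpos_imp_linear_coeff_zero: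
  fixes e c :: real
  assumes "\<And>t. 2 * t * e + t\<^sup>2 * c \<le> 0"
  shows "e = 0"
proof -
  define s where "s = 1 / (1 + \<bar>c\<bar>)"
  have s: "0 < s" "s * \<bar>c\<bar> \<le> 1" by (simp_all add: s_def field_simps)
  have "s * (e\<^sup>2 * (2 + s * c)) \<le> 0"
    using assms[of "s * e"] by (simp add: algebra_simps power2_eq_square)
  then have "e\<^sup>2 * (2 + s * c) \<le> 0"
    using s(1) by (simp add: mult_le_0_iff)
  moreover have "s * \<bar>c\<bar> = \<bar>s * c\<bar>" using s(1) by (simp add: abs_mult)
  then have "2 + s * c > 0" using s(2) by linarith
  ultimately show ?thesis by (simp add: mult_le_0_iff)
qed

text \<open>Vectors are functions on the whole type; fixing them to 0 off \<open>V\<close> makes the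
  set a closed part of a product of compact sets, so Tychonoff applies.\<close>

lemma compact_unit_sphere_nonneg_orthant:
  fixes V :: "'v set"
  assumes "finite V"
  shows "compact {x :: 'v \<Rightarrow> real. (\<forall>v. x v \<in> (if v \<in> V then {0..1} else {0})) \<and>
    (\<Sum>v\<in>V. (x v)\<^sup>2) = 1}"
proof -
  let ?S = "\<lambda>v. if v \<in> V then {0..1} else {0::real}"
  have "compactin (product_topology (\<lambda>_::'v. euclidean) UNIV) (PiE UNIV ?S)"
    by (subst compactin_PiE) auto
  then have "compact (PiE UNIV ?S)" by (simp add: euclidean_product_topology)
  moreover have "closed {x :: 'v \<Rightarrow> real. (\<Sum>v\<in>V. (x v)\<^sup>2) = 1}"
    by (intro closed_Collect_eq continuous_intros continuous_on_product_coordinates)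
  moreover have "{x :: 'v \<Rightarrow> real. (\<forall>v. x v \<in> ?S v) \<and> (\<Sum>v\<in>V. (x v)\<^sup>2) = 1} =
      PiE UNIV ?S \<inter> {x. (\<Sum>v\<in>V. (x v)\<^sup>2) = 1}"
    by (simp only: PiE_UNIV_domain Pi_def) blast
  ultimately show ?thesis by (simp only: compact_Int_closed)
qed

text \<open>A maximiser of the quadratic form \<open>Q\<close> over nonnegative unit vectors. As the
  entries are nonnegative, absolute values do not decrease \<open>Q\<close>, so \<open>\<mu>\<close>
  bounds the Rayleigh quotient of every vector, in particular of every eigenvector. The eigenvector
  equation is the first-order condition at the maximiser.\<close>

lemma symmetric_nonneg_matrix_top_eigenvector:
  fixes A :: "'v \<Rightarrow> 'v \<Rightarrow> real"
  assumes fin: "finite V" and "V \<noteq> {}"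
    and sym: "\<And>u v. u \<in> V \<Longrightarrow> v \<in> V \<Longrightarrow> A u v = A v u"
    and nonneg: "\<And>u v. u \<in> V \<Longrightarrow> v \<in> V \<Longrightarrow> 0 \<le> A u v"
  shows "\<exists>x \<mu>. (\<forall>v\<in>V. 0 \<le> x v) \<and> (\<exists>v\<in>V. x v \<noteq> 0) \<and>
    (\<forall>u\<in>V. (\<Sum>v\<in>V. A u v * x v) = \<mu> * x u) \<and> (\<forall>c\<in>matrix_eigenvalues V A. c \<le> \<mu>)"
proof -
  define Q where "Q z = (\<Sum>u\<in>V. \<Sum>v\<in>V. A u v * z u * z v)" for z
  define N where "N z = (\<Sum>v\<in>V. (z v)\<^sup>2)" for z :: "'v \<Rightarrow> real"
  define K where "K = {x :: 'v \<Rightarrow> real. (\<forall>v. x v \<in> (if v \<in> V then {0..1} else {0})) \<and> N x = 1}"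
  have "compact K"
    unfolding K_def N_def by (rule compact_unit_sphere_nonneg_orthant[OF fin])
  moreover have "K \<noteq> {}"
  proof -
    obtain v0 where "v0 \<in> V" using \<open>V \<noteq> {}\<close> by blast
    let ?x = "\<lambda>v. if v = v0 then 1 else 0 :: real"
    have "N ?x = (\<Sum>v\<in>V. ?x v)" unfolding N_def by (intro sum.cong) auto
    also have "\<dots> = 1" using fin \<open>v0 \<in> V\<close> by simp
    finally have "?x \<in> K" using \<open>v0 \<in> V\<close> by (auto simp: K_def)
    then show ?thesis by blast
  qed
  moreover have "continuous_on K Q"
    unfolding Q_def
    by (intro continuous_intros continuous_on_subset[OF continuous_on_product_coordinates]) auto
  ultimately have "\<exists>x\<in>K. \<forall>z\<in>K. Q z \<le> Q x" by (rule continuous_attains_sup)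
  then obtain x where x: "x \<in> K" and max: "\<And>z. z \<in> K \<Longrightarrow> Q z \<le> Q x" by blast
  define \<mu> where "\<mu> = Q x"
  have x1: "N x = 1" using x by (simp add: K_def)
  have x0: "0 \<le> x v" if "v \<in> V" for v
  proof -
    have "x v \<in> (if v \<in> V then {0..1} else {0})" using x unfolding K_def by blast
    then show ?thesis using that by simp
  qed
  have bound: "Q z \<le> \<mu> * N z" for z
  proof (cases "N z = 0")
    case True
    then have "\<And>v. v \<in> V \<Longrightarrow> z v = 0"
      using fin by (simp add: N_def sum_nonneg_eq_0_iff)
    then show ?thesis using True by (simp add: Q_def)
  next
    case False
    moreover have "N z \<ge> 0" by (simp add: N_def sum_nonneg)
    ultimately have pos: "N z > 0" by simp
    \<comment> \<open>The normalised vector of absolute values is a competitor in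
      \<open>K\<close>.\<close>
    define w where "w v = (if v \<in> V then \<bar>z v\<bar> / sqrt (N z) else 0)" for v
    have "\<bar>z v\<bar> \<le> sqrt (N z)" if "v \<in> V" for v
      using that fin by (intro real_le_rsqrt) (auto simp: N_def intro: member_le_sum)
    moreover have "N w = 1"
    proof -
      have "N w = (\<Sum>v\<in>V. (z v)\<^sup>2 / N z)"
        unfolding N_def[of w] using pos by (intro sum.cong) (auto simp: w_def power_divide)
      also have "\<dots> = 1" using pos by (simp add: sum_divide_distrib[symmetric] N_def[symmetric])
      finally show ?thesis .
    qed
    ultimately have "w \<in> K"
      using pos by (auto simp: K_def w_def)
    then have "Q w \<le> \<mu>" using max by (simp add: \<mu>_def)
    moreover have "Q w = (\<Sum>u\<in>V. \<Sum>v\<in>V. A u v * \<bar>z u\<bar> * \<bar>z v\<bar>) / N z"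
    proof -
      have "Q w = (\<Sum>u\<in>V. \<Sum>v\<in>V. A u v * \<bar>z u\<bar> * \<bar>z v\<bar> / N z)"
        unfolding Q_def using pos by (intro sum.cong) (auto simp: w_def)
      then show ?thesis by (simp add: sum_divide_distrib)
    qed
    moreover have "Q z \<le> (\<Sum>u\<in>V. \<Sum>v\<in>V. A u v * \<bar>z u\<bar> * \<bar>z v\<bar>)"
      unfolding Q_def
    proof (intro sum_mono)
      fix u v assume "u \<in> V" "v \<in> V"
      then have "A u v * (z u * z v) \<le> A u v * (\<bar>z u\<bar> * \<bar>z v\<bar>)"
        using nonneg by (intro mult_left_mono) (auto simp: abs_mult[symmetric])
      then show "A u v * z u * z v \<le> A u v * \<bar>z u\<bar> * \<bar>z v\<bar>" by (simp add: mult.assoc)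
    qed
    ultimately show ?thesis using pos by (simp add: field_simps)
  qed
  have "(\<Sum>v\<in>V. A u v * x v) = \<mu> * x u" if u: "u \<in> V" for u
  proof -
    \<comment> \<open>The left-hand side is \<open>Q z - \<mu> * N z\<close> for \<open>x\<close>
      perturbed by \<open>t\<close> in the coordinate \<open>u\<close>.\<close>
    have "2 * t * ((\<Sum>v\<in>V. A u v * x v) - \<mu> * x u) + t\<^sup>2 * (A u u - \<mu>) \<le> 0" for t
    proof -
      define z where "z v = x v + (if v = u then t else 0)" for v
      have "Q z = (\<Sum>a\<in>V. \<Sum>b\<in>V. A a b * x a * x b + (if a = u then t * (A a b * x b) else 0)
          + (if b = u then t * (A a b * x a) else 0)
          + (if a = u then if b = u then t\<^sup>2 * A a b else 0 else 0))"
        unfolding Q_def z_def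
        by (intro sum.cong) (auto simp: algebra_simps power2_eq_square)
      also have "\<dots> = \<mu> + t * (\<Sum>v\<in>V. A u v * x v) + t * (\<Sum>v\<in>V. A v u * x v) + t\<^sup>2 * A u u"
      proof -
        have "(\<Sum>a\<in>V. \<Sum>b\<in>V. if a = u then t * (A a b * x b) else 0) = t * (\<Sum>v\<in>V. A u v * x v)"
          by (subst sum.swap) (use fin u in \<open>simp add: sum_distrib_left\<close>)
        moreover have "(\<Sum>a\<in>V. \<Sum>b\<in>V. if a = u then if b = u then t\<^sup>2 * A a b else 0 else 0) = t\<^sup>2 * A u u"
          by (subst sum.swap) (use fin u in simp)
        ultimately show ?thesis
          using fin u by (simp add: sum.distrib \<mu>_def Q_def sum_distrib_left)
      qed
      also have "(\<Sum>v\<in>V. A v u * x v) = (\<Sum>v\<in>V. A u v * x v)"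
        using sym u by (intro sum.cong) auto
      finally have Qz: "Q z = \<mu> + 2 * t * (\<Sum>v\<in>V. A u v * x v) + t\<^sup>2 * A u u" by simp
      have "N z = (\<Sum>v\<in>V. (x v)\<^sup>2 + (if v = u then 2 * t * x v + t\<^sup>2 else 0))"
        unfolding N_def z_def by (intro sum.cong) (auto simp: power2_eq_square algebra_simps)
      also have "\<dots> = 1 + 2 * t * x u + t\<^sup>2"
        using fin u x1 by (simp add: sum.distrib N_def)
      finally have "N z = 1 + 2 * t * x u + t\<^sup>2" .
      then show ?thesis using bound[of z] Qz by (simp add: algebra_simps)
    qed
    then have "(\<Sum>v\<in>V. A u v * x v) - \<mu> * x u = 0"
      by (rule quadratic_nonpos_imp_linear_coeff_zero)
    then show ?thesis by simp
  qed
  moreover have "c \<le> \<mu>" if "c \<in> matrix_eigenvalues V A" for c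
  proof -
    obtain z where z: "\<exists>v\<in>V. z v \<noteq> 0" "\<And>u. u \<in> V \<Longrightarrow> (\<Sum>v\<in>V. A u v * z v) = c * z u"
      using \<open>c \<in> _\<close> by (auto simp: matrix_eigenvalues_def)
    have "Q z = (\<Sum>u\<in>V. z u * (\<Sum>v\<in>V. A u v * z v))"
      by (simp add: Q_def sum_distrib_left algebra_simps)
    also have "\<dots> = c * N z"
      using z(2) by (simp add: N_def sum_distrib_left power2_eq_square algebra_simps)
    finally have "c * N z \<le> \<mu> * N z" using bound[of z] by simp
    moreover have "N z > 0"
      using z(1) fin by (auto simp: N_def intro: sum_pos2)
    ultimately show ?thesis by simp
  qed
  moreover have "\<exists>v\<in>V. x v \<noteq> 0"
  proof (rule ccontr)
    assume "\<not> ?thesis"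
    then show False using x1 by (simp add: N_def)
  qed
  ultimately show ?thesis using x0 by (intro exI[of _ x] exI[of _ \<mu>]) auto
qed

text \<open>Bessel's inequality for unit vectors: \<open>?p\<close> below is the orthogonal
  projection of the indicator of \<open>w\<close> onto the span of the family, and its value at
  \<open>w\<close> equals its squared norm, hence is at most 1. Summing these values over
  \<open>w\<close> gives \<open>card K\<close>.\<close>

lemma card_orthonormal_le:
  fixes f :: "'k \<Rightarrow> 'v \<Rightarrow> real"
  assumes "finite V" "finite K"
    and orth: "\<And>k l. k \<in> K \<Longrightarrow> l \<in> K \<Longrightarrow> (\<Sum>v\<in>V. f k v * f l v) = of_bool (k = l)"
  shows "card K \<le> card V"
proof -
  have "(\<Sum>k\<in>K. (f k w)\<^sup>2) \<le> 1" if w: "w \<in> V" for w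
  proof -
    let ?p = "\<lambda>v. \<Sum>k\<in>K. f k w * f k v"
    have "(\<Sum>v\<in>V. ?p v * ?p v) = (\<Sum>k\<in>K. \<Sum>l\<in>K. f k w * f l w * (\<Sum>v\<in>V. f k v * f l v))"
    proof -
      have "(\<Sum>v\<in>V. ?p v * ?p v) = (\<Sum>v\<in>V. \<Sum>k\<in>K. \<Sum>l\<in>K. f k w * f l w * (f k v * f l v))"
        by (simp add: sum_product algebra_simps)
      also have "\<dots> = (\<Sum>k\<in>K. \<Sum>v\<in>V. \<Sum>l\<in>K. f k w * f l w * (f k v * f l v))"
        by (rule sum.swap)
      also have "\<dots> = (\<Sum>k\<in>K. \<Sum>l\<in>K. \<Sum>v\<in>V. f k w * f l w * (f k v * f l v))"
        by (intro sum.cong refl sum.swap)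
      finally show ?thesis by (simp add: sum_distrib_left)
    qed
    also have "\<dots> = (\<Sum>k\<in>K. \<Sum>l\<in>K. if k = l then f k w * f l w else 0)"
      using orth by (intro sum.cong) auto
    also have "\<dots> = ?p w"
      using assms(2) by simp
    finally have "(\<Sum>v\<in>V. ?p v * ?p v) = ?p w" .
    moreover have "?p w * ?p w \<le> (\<Sum>v\<in>V. ?p v * ?p v)"
      using assms(1) w by (intro member_le_sum) auto
    ultimately have "?p w * ?p w \<le> ?p w" by simp
    have "?p w \<le> 1"
    proof (rule ccontr)
      assume "\<not> ?p w \<le> 1"
      then have "1 * ?p w < ?p w * ?p w" by (intro mult_strict_right_mono) linarith+
      then show False using \<open>?p w * ?p w \<le> ?p w\<close> by simp
    qed
    then show ?thesis by (simp add: power2_eq_square)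
  qed
  then have "(\<Sum>w\<in>V. \<Sum>k\<in>K. (f k w)\<^sup>2) \<le> (\<Sum>w\<in>V. 1)" by (intro sum_mono) auto
  moreover have "(\<Sum>w\<in>V. \<Sum>k\<in>K. (f k w)\<^sup>2) = card K"
    using orth by (subst sum.swap) (simp add: power2_eq_square)
  ultimately show ?thesis by simp
qed

text \<open>Makes the \<open>Max\<close> in \<open>lambda1\<close> meaningful. Eigenvectors of
  different eigenvalues are orthogonal, so more than \<open>card V\<close> eigenvalues would give
  too many orthonormal vectors.\<close>

lemma finite_symmetric_matrix_eigenvalues:
  fixes A :: "'v \<Rightarrow> 'v \<Rightarrow> real"
  assumes "finite V" and sym: "\<And>u v. u \<in> V \<Longrightarrow> v \<in> V \<Longrightarrow> A u v = A v u"
  shows "finite (matrix_eigenvalues V A)"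
proof (rule ccontr)
  assume "\<not> ?thesis"
  then obtain K where K: "K \<subseteq> matrix_eigenvalues V A" "finite K" "card K = Suc (card V)"
    using infinite_arbitrarily_large by metis
  have "\<forall>c\<in>K. \<exists>x. (\<exists>v\<in>V. x v \<noteq> 0) \<and> (\<forall>u\<in>V. (\<Sum>v\<in>V. A u v * x v) = c * x u)"
    using K(1) by (auto simp: matrix_eigenvalues_def)
  then have "\<exists>x. \<forall>c\<in>K. (\<exists>v\<in>V. x c v \<noteq> 0) \<and> (\<forall>u\<in>V. (\<Sum>v\<in>V. A u v * x c v) = c * x c u)"
    by (rule bchoice)
  then obtain x where x: "\<And>c. c \<in> K \<Longrightarrow> \<exists>v\<in>V. x c v \<noteq> 0"
    "\<And>c u. c \<in> K \<Longrightarrow> u \<in> V \<Longrightarrow> (\<Sum>v\<in>V. A u v * x c v) = c * x c u"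
    by auto
  define N where "N c = (\<Sum>v\<in>V. (x c v)\<^sup>2)" for c
  have N: "N c > 0" if "c \<in> K" for c
    using x(1)[OF that] assms(1) by (auto simp: N_def intro: sum_pos2)
  have orth: "(\<Sum>v\<in>V. x c v * x d v) = 0" if "c \<in> K" "d \<in> K" "c \<noteq> d" for c d
  proof -
    have "c * (\<Sum>v\<in>V. x c v * x d v) = (\<Sum>u\<in>V. (\<Sum>v\<in>V. A u v * x c v) * x d u)"
      using x(2) that by (simp add: sum_distrib_left mult.assoc)
    also have "\<dots> = (\<Sum>u\<in>V. \<Sum>v\<in>V. A u v * x c v * x d u)"
      by (simp add: sum_distrib_right)
    also have "\<dots> = (\<Sum>v\<in>V. \<Sum>u\<in>V. A u v * x c v * x d u)" by (rule sum.swap)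
    also have "\<dots> = (\<Sum>v\<in>V. x c v * (\<Sum>u\<in>V. A v u * x d u))"
      unfolding sum_distrib_left using sym by (intro sum.cong) (auto simp: mult_ac)
    also have "\<dots> = d * (\<Sum>v\<in>V. x c v * x d v)"
      using x(2) that by (simp add: sum_distrib_left mult_ac)
    finally show ?thesis using \<open>c \<noteq> d\<close> by simp
  qed
  define f where "f c v = x c v / sqrt (N c)" for c v
  have "(\<Sum>v\<in>V. f c v * f d v) = of_bool (c = d)" if "c \<in> K" "d \<in> K" for c d
  proof -
    have "(\<Sum>v\<in>V. f c v * f d v) = (\<Sum>v\<in>V. x c v * x d v) / (sqrt (N c) * sqrt (N d))"
      by (simp add: f_def sum_divide_distrib)
    then show ?thesis
      using orth[OF that] N[OF that(1)] by (cases "c = d") (auto simp: N_def power2_eq_square)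
  qed
  then have "card K \<le> card V"
    using card_orthonormal_le[OF assms(1) K(2)] by blast
  then show False using K(3) by simp
qed

lemma (in fin_digraph) sum_adjacency_matrix:
  assumes "u \<in> verts G"
  shows "(\<Sum>v\<in>verts G. adjacency_matrix G u v * x v) = (\<Sum>a\<in>out_arcs G u. x (head G a))"
proof -
  have eq: "(\<Sum>a\<in>{a \<in> out_arcs G u. head G a = v}. x (head G a)) =
      adjacency_matrix G u v * x v" for v
  proof -
    have "{a \<in> out_arcs G u. head G a = v} = {a \<in> arcs G. tail G a = u \<and> head G a = v}" by auto
    then show ?thesis by (simp add: adjacency_matrix_def)
  qed
  have "(\<Sum>v\<in>verts G. adjacency_matrix G u v * x v) =
      (\<Sum>v\<in>verts G. \<Sum>a\<in>{a \<in> out_arcs G u. head G a = v}. x (head G a))"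
    by (simp only: eq)
  also have "\<dots> = (\<Sum>a\<in>out_arcs G u. x (head G a))"
    by (rule sum.group) auto
  finally show ?thesis .
qed

lemma (in bidirected_digraph) adjacency_matrix_commute:
  "adjacency_matrix G u v = adjacency_matrix G v u"
proof -
  have "bij_betw arev {a \<in> arcs G. tail G a = u \<and> head G a = v} {a \<in> arcs G. tail G a = v \<and> head G a = u}"
    by (rule bij_betw_byWitness[where f' = arev]) auto
  then show ?thesis by (simp add: adjacency_matrix_def bij_betw_same_card)
qed

lemma (in bidirected_digraph) exists_Perron_eigenvector:
  assumes "fin_digraph G" "Digraph_Component.connected G"
  shows "\<exists>x. (\<forall>v\<in>verts G. 0 < x v) \<and>
    (\<forall>v\<in>verts G. (\<Sum>a\<in>out_arcs G v. x (head G a)) = lambda1 G * x v)"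
proof -
  interpret fin_digraph G by fact
  let ?A = "adjacency_matrix G"
  have "verts G \<noteq> {}" using assms(2) by (simp add: connected_conv)
  then have "\<exists>x \<mu>. (\<forall>v\<in>verts G. 0 \<le> x v) \<and> (\<exists>v\<in>verts G. x v \<noteq> 0) \<and>
      (\<forall>u\<in>verts G. (\<Sum>v\<in>verts G. ?A u v * x v) = \<mu> * x u) \<and>
      (\<forall>c\<in>matrix_eigenvalues (verts G) ?A. c \<le> \<mu>)"
    by (rule symmetric_nonneg_matrix_top_eigenvector[OF finite_verts _ adjacency_matrix_commute])
      (simp add: adjacency_matrix_def)
  then obtain x \<mu> where x: "\<forall>v\<in>verts G. 0 \<le> x v" "\<exists>v\<in>verts G. x v \<noteq> 0"
    "\<forall>u\<in>verts G. (\<Sum>v\<in>verts G. ?A u v * x v) = \<mu> * x u"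
    "\<forall>c\<in>matrix_eigenvalues (verts G) ?A. c \<le> \<mu>"
    by blast
  have "\<mu> \<in> matrix_eigenvalues (verts G) ?A" using x(2,3) by (auto simp: matrix_eigenvalues_def)
  then have \<mu>: "lambda1 G = \<mu>"
    unfolding lambda1_def using x(4)
    by (intro Max_eqI finite_symmetric_matrix_eigenvalues[OF finite_verts adjacency_matrix_commute])
      auto
  have eig: "(\<Sum>a\<in>out_arcs G v. x (head G a)) = \<mu> * x v" if "v \<in> verts G" for v
    using x(3) that by (simp add: sum_adjacency_matrix)
  \<comment> \<open>Zeros spread: at a zero of \<open>x\<close> the eigenvector equation makes a sum
    of nonnegative neighbour values vanish. By connectedness \<open>x\<close> would be zero
    everywhere.\<close>
  have "x v > 0" if v: "v \<in> verts G" for v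
  proof (rule ccontr)
    assume "\<not> 0 < x v"
    then have "x v = 0" using x(1) v by (metis less_eq_real_def)
    obtain w where w: "w \<in> verts G" "x w \<noteq> 0" using x(2) by blast
    have "(v, w) \<in> ((\<lambda>a. (tail G a, head G a)) ` arcs G)\<^sup>*"
      using connected_by_arcs[OF assms(2)] v w by (auto simp: connected_by_def)
    then have "\<exists>s t. (s, t) \<in> (\<lambda>a. (tail G a, head G a)) ` arcs G \<and> s \<in> {u. x u = 0} \<and> t \<notin> {u. x u = 0}"
      by (rule rtrancl_crossing) (use \<open>x v = 0\<close> w in auto)
    then obtain a where a: "a \<in> arcs G" "x (tail G a) = 0" "x (head G a) \<noteq> 0" by auto
    have sum0: "(\<Sum>b\<in>out_arcs G (tail G a). x (head G b)) = 0"
      using eig[of "tail G a"] a by simp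
    have "0 \<le> x (head G b)" if "b \<in> out_arcs G (tail G a)" for b
      using x(1) that by simp
    then have "\<forall>b\<in>out_arcs G (tail G a). x (head G b) = 0"
      using sum0 by (rule iffD1[OF sum_nonneg_eq_0_iff[OF finite_out_arcs]])
    then show False using a by simp
  qed
  then show ?thesis unfolding \<mu> using eig by (intro exI[of _ x]) simp
qed

section \<open>The Schur test\<close>

lemma ell2_finite_support:
  assumes "finite S" "S \<subseteq> V" "\<And>v. v \<in> V - S \<Longrightarrow> f v = 0"
  shows "f \<in> ell2 V" "ell2_norm V f = sqrt (\<Sum>v\<in>S. (cmod (f v))\<^sup>2)"
proof -
  have "(\<lambda>v. (cmod (f v))\<^sup>2) summable_on V \<longleftrightarrow> (\<lambda>v. (cmod (f v))\<^sup>2) summable_on S"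
    using assms by (intro summable_on_cong_neutral) auto
  then show "f \<in> ell2 V" using assms(1) by (simp add: ell2_def)
  have "(\<Sum>\<^sub>\<infinity>v\<in>V. (cmod (f v))\<^sup>2) = (\<Sum>\<^sub>\<infinity>v\<in>S. (cmod (f v))\<^sup>2)"
    using assms by (intro infsum_cong_neutral) auto
  then show "ell2_norm V f = sqrt (\<Sum>v\<in>S. (cmod (f v))\<^sup>2)"
    using assms(1) by (simp add: ell2_norm_def)
qed

lemma sum_le_ell2_norm_square:
  assumes "f \<in> ell2 V" "finite S" "S \<subseteq> V"
  shows "(\<Sum>v\<in>S. (cmod (f v))\<^sup>2) \<le> (ell2_norm V f)\<^sup>2"
proof -
  have "(\<Sum>v\<in>S. (cmod (f v))\<^sup>2) \<le> (\<Sum>\<^sub>\<infinity>v\<in>V. (cmod (f v))\<^sup>2)"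
    using assms by (intro finite_sum_le_infsum) (auto simp: ell2_def)
  moreover have "0 \<le> (\<Sum>\<^sub>\<infinity>v\<in>V. (cmod (f v))\<^sup>2)" by (intro infsum_nonneg) auto
  ultimately show ?thesis by (simp add: ell2_norm_def)
qed

lemma ell2_norm_nonneg: "0 \<le> ell2_norm V f"
  by (auto simp: ell2_norm_def intro: infsum_nonneg)

lemma ell2_if_bounded_sums:
  assumes "\<And>F. finite F \<Longrightarrow> F \<subseteq> V \<Longrightarrow> (\<Sum>v\<in>F. (cmod (f v))\<^sup>2) \<le> B\<^sup>2" "0 \<le> B"
  shows "f \<in> ell2 V" "ell2_norm V f \<le> B"
proof -
  have summable: "(\<lambda>v. (cmod (f v))\<^sup>2) summable_on V"
    using assms(1) by (intro nonneg_bdd_above_summable_on) (auto intro!: bdd_aboveI2)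
  then show "f \<in> ell2 V" by (simp add: ell2_def)
  have "(\<Sum>\<^sub>\<infinity>v\<in>V. (cmod (f v))\<^sup>2) \<le> B\<^sup>2"
    using summable assms(1) by (intro infsum_le_finite_sums) auto
  then show "ell2_norm V f \<le> B"
    unfolding ell2_norm_def using assms(2) by (intro real_le_lsqrt infsum_nonneg) auto
qed

text \<open>For weights \<open>y (head G a) / y (tail G a)\<close> with positive \<open>y\<close>,
  \<open>weight_sum\<close> says that the adjacency operator maps \<open>y\<close> to at most
  \<open>K * y\<close>, the usual Schur condition. Arc weights can be prescribed locally, without
  constructing \<open>y\<close>.\<close>

locale weighted_bidirected_digraph = bidirected_digraph G arev
  for G :: "('a, 'b) pre_digraph" and arev :: "'b \<Rightarrow> 'b" +
  fixes c :: "'b \<Rightarrow> real" and K :: real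
  assumes locally_finite: "\<And>v. v \<in> verts G \<Longrightarrow> finite (out_arcs G v)"
    and weight_pos: "\<And>a. a \<in> arcs G \<Longrightarrow> 0 < c a"
    and weight_arev: "\<And>a. a \<in> arcs G \<Longrightarrow> c a * c (arev a) = 1"
    and weight_sum: "\<And>v. v \<in> verts G \<Longrightarrow> (\<Sum>a\<in>out_arcs G v. c a) \<le> K"
    and bound_nonneg: "0 \<le> K"
begin

text \<open>Cauchy-Schwarz after inserting the factor
  \<open>sqrt (c a) * sqrt (c (arev a)) = 1\<close>. The right-hand side is written in terms of
  \<open>arev a\<close> to prepare for reindexing by reversal.\<close>

lemma adjacency_op_square_le:
  assumes "v \<in> verts G"
  shows "(cmod (adjacency_op G f v))\<^sup>2 \<le>
    K * (\<Sum>a\<in>out_arcs G v. (cmod (f (tail G (arev a))))\<^sup>2 * c (arev a))"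
proof -
  let ?O = "out_arcs G v"
  have "cmod (adjacency_op G f v) \<le> (\<Sum>a\<in>?O. cmod (f (head G a)))"
    unfolding adjacency_op_def by (rule norm_sum)
  also have "\<dots> = (\<Sum>a\<in>?O. sqrt (c a) * (cmod (f (head G a)) * sqrt (c (arev a))))"
  proof (rule sum.cong)
    fix a assume "a \<in> ?O"
    then have "sqrt (c a) * sqrt (c (arev a)) = 1"
      using weight_arev[of a] real_sqrt_mult[of "c a" "c (arev a)"] by simp
    then show "cmod (f (head G a)) = sqrt (c a) * (cmod (f (head G a)) * sqrt (c (arev a)))"
      by (simp add: mult.left_commute)
  qed simp
  finally have "(cmod (adjacency_op G f v))\<^sup>2 \<le>
      (\<Sum>a\<in>?O. sqrt (c a) * (cmod (f (head G a)) * sqrt (c (arev a))))\<^sup>2"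
    by (intro power_mono) auto
  also have "\<dots> \<le> (\<Sum>a\<in>?O. (sqrt (c a))\<^sup>2) * (\<Sum>a\<in>?O. (cmod (f (head G a)) * sqrt (c (arev a)))\<^sup>2)"
    by (rule Cauchy_Schwarz_ineq_sum)
  also have "(\<Sum>a\<in>?O. (sqrt (c a))\<^sup>2) = (\<Sum>a\<in>?O. c a)"
    using weight_pos by (intro sum.cong) (auto simp: less_imp_le)
  also have "(\<Sum>a\<in>?O. (cmod (f (head G a)) * sqrt (c (arev a)))\<^sup>2) =
      (\<Sum>a\<in>?O. (cmod (f (tail G (arev a))))\<^sup>2 * c (arev a))"
    using weight_pos by (intro sum.cong) (auto simp: power_mult_distrib less_imp_le)
  also have "(\<Sum>a\<in>?O. c a) * (\<Sum>a\<in>?O. (cmod (f (tail G (arev a))))\<^sup>2 * c (arev a)) \<le>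
      K * (\<Sum>a\<in>?O. (cmod (f (tail G (arev a))))\<^sup>2 * c (arev a))"
    using weight_sum[OF assms] weight_pos
    by (intro mult_right_mono sum_nonneg) (auto simp: less_imp_le)
  finally show ?thesis .
qed

text \<open>One factor \<open>K\<close> comes from the pointwise bound. Reversal turns the arcs
  leaving \<open>F\<close> into arcs leaving the set \<open>H\<close> of neighbours, and the star
  sums at \<open>H\<close> supply the second factor.\<close>

lemma sum_adjacency_op_square_le:
  assumes f: "f \<in> ell2 (verts G)" and F: "finite F" "F \<subseteq> verts G"
  shows "(\<Sum>v\<in>F. (cmod (adjacency_op G f v))\<^sup>2) \<le> (K * ell2_norm (verts G) f)\<^sup>2"
proof -
  let ?g = "\<lambda>b. (cmod (f (tail G b)))\<^sup>2 * c b"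
  define X where "X = (\<Union>v\<in>F. out_arcs G v)"
  define H where "H = head G ` X"
  have fin: "finite X" "finite H" and sub: "X \<subseteq> arcs G" "H \<subseteq> verts G"
    using F locally_finite by (auto simp: X_def H_def)
  have "(\<Sum>v\<in>F. \<Sum>a\<in>out_arcs G v. ?g (arev a)) = (\<Sum>a\<in>X. ?g (arev a))"
    unfolding X_def using F locally_finite by (subst sum.UNION_disjoint) auto
  also have "\<dots> = (\<Sum>b\<in>arev ` X. ?g b)"
    by (subst sum.reindex) (auto simp: o_def)
  \<comment> \<open>The reversed arcs are completed to full stars, to which
    \<open>weight_sum\<close> applies.\<close>
  also have "\<dots> \<le> (\<Sum>b\<in>(\<Union>u\<in>H. out_arcs G u). ?g b)"
  proof (rule sum_mono2)
    show "finite (\<Union>u\<in>H. out_arcs G u)" using fin sub locally_finite by auto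
    show "arev ` X \<subseteq> (\<Union>u\<in>H. out_arcs G u)" using sub(1) by (fastforce simp: H_def)
    show "0 \<le> ?g b" if "b \<in> (\<Union>u\<in>H. out_arcs G u) - arev ` X" for b
      using that weight_pos[of b] by auto
  qed
  also have "\<dots> = (\<Sum>u\<in>H. \<Sum>b\<in>out_arcs G u. ?g b)"
    using fin sub locally_finite by (subst sum.UNION_disjoint) auto
  also have "\<dots> = (\<Sum>u\<in>H. (cmod (f u))\<^sup>2 * (\<Sum>b\<in>out_arcs G u. c b))"
    by (simp add: sum_distrib_left)
  also have "\<dots> \<le> (\<Sum>u\<in>H. (cmod (f u))\<^sup>2 * K)"
    using sub weight_sum by (intro sum_mono mult_left_mono) auto
  also have "\<dots> = K * (\<Sum>u\<in>H. (cmod (f u))\<^sup>2)"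
    by (simp add: sum_distrib_left mult.commute)
  also have "\<dots> \<le> K * (ell2_norm (verts G) f)\<^sup>2"
    using bound_nonneg sum_le_ell2_norm_square[OF f fin(2) sub(2)] by (intro mult_left_mono)
  finally have le: "(\<Sum>v\<in>F. \<Sum>a\<in>out_arcs G v. ?g (arev a)) \<le> K * (ell2_norm (verts G) f)\<^sup>2" .
  have "(\<Sum>v\<in>F. (cmod (adjacency_op G f v))\<^sup>2) \<le>
      (\<Sum>v\<in>F. K * (\<Sum>a\<in>out_arcs G v. ?g (arev a)))"
    using F adjacency_op_square_le by (intro sum_mono) auto
  also have "\<dots> = K * (\<Sum>v\<in>F. \<Sum>a\<in>out_arcs G v. ?g (arev a))"
    by (simp add: sum_distrib_left)
  also have "\<dots> \<le> K * (K * (ell2_norm (verts G) f)\<^sup>2)"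
    using le bound_nonneg by (rule mult_left_mono)
  also have "\<dots> = (K * ell2_norm (verts G) f)\<^sup>2" by (simp add: power2_eq_square mult_ac)
  finally show ?thesis .
qed

lemma adjacency_op_in_ell2:
  assumes "f \<in> ell2 (verts G)"
  shows "adjacency_op G f \<in> ell2 (verts G)"
  and "ell2_norm (verts G) (adjacency_op G f) \<le> K * ell2_norm (verts G) f"
  by (rule ell2_if_bounded_sums[OF sum_adjacency_op_square_le[OF assms]
        mult_nonneg_nonneg[OF bound_nonneg ell2_norm_nonneg]]; assumption)+

lemma adjacency_op_unit_ball_le:
  assumes "f \<in> {f \<in> ell2 (verts G). ell2_norm (verts G) f \<le> 1}"
  shows "ell2_norm (verts G) (adjacency_op G f) \<le> K"
proof -
  have "K * ell2_norm (verts G) f \<le> K * 1"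
    using assms bound_nonneg by (intro mult_left_mono) auto
  then show ?thesis using adjacency_op_in_ell2(2)[of f] assms by auto
qed

lemma rho_le: "rho G \<le> K"
  unfolding rho_def
proof (rule cSUP_least)
  have "(\<lambda>_. 0) \<in> {f \<in> ell2 (verts G). ell2_norm (verts G) f \<le> 1}"
    by (simp add: ell2_def ell2_norm_def)
  then show "{f \<in> ell2 (verts G). ell2_norm (verts G) f \<le> 1} \<noteq> {}" by blast
qed (rule adjacency_op_unit_ball_le)

lemma norm_adjacency_op_le_rho:
  assumes "f \<in> ell2 (verts G)" "ell2_norm (verts G) f \<le> 1"
  shows "ell2_norm (verts G) (adjacency_op G f) \<le> rho G"
  unfolding rho_def
proof (rule cSUP_upper)
  show "f \<in> {f \<in> ell2 (verts G). ell2_norm (verts G) f \<le> 1}" using assms by simp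
qed (rule bdd_aboveI2[where M = K], rule adjacency_op_unit_ball_le)

text \<open>The test function is \<open>y\<close>, cut off outside \<open>S\<close> and normalised.
  Cauchy-Schwarz bounds its quadratic form by the norm of its image on \<open>S\<close>; the values
  of the image outside \<open>S\<close> only add to the norm.\<close>

lemma Rayleigh_quotient_le_rho:
  fixes y :: "'a \<Rightarrow> real"
  assumes S: "finite S" "S \<subseteq> verts G" and pos: "(\<Sum>v\<in>S. (y v)\<^sup>2) > 0"
  shows "(\<Sum>v\<in>S. y v * (\<Sum>a\<in>out_arcs G v. if head G a \<in> S then y (head G a) else 0)) \<le>
    rho G * (\<Sum>v\<in>S. (y v)\<^sup>2)"
proof -
  define Y where "Y = (\<Sum>v\<in>S. (y v)\<^sup>2)"
  define g where "g v = (\<Sum>a\<in>out_arcs G v. if head G a \<in> S then y (head G a) else 0)" for v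
  define f where "f v = (if v \<in> S then complex_of_real (y v / sqrt Y) else 0)" for v
  have Y: "Y > 0" using pos by (simp add: Y_def)
  have normalized: "(\<Sum>v\<in>S. (y v / sqrt Y)\<^sup>2) = 1"
    using Y by (simp add: power_divide sum_divide_distrib[symmetric] Y_def[symmetric])
  have "(\<Sum>v\<in>S. (cmod (f v))\<^sup>2) = (\<Sum>v\<in>S. (y v / sqrt Y)\<^sup>2)"
    by (intro sum.cong) (auto simp: f_def norm_divide power_divide)
  then have f: "f \<in> ell2 (verts G)" "ell2_norm (verts G) f = 1"
    using ell2_finite_support[OF S, of f] normalized by (auto simp: f_def)
  have Af: "adjacency_op G f v = complex_of_real (g v / sqrt Y)" for v
  proof -
    have "adjacency_op G f v =
        (\<Sum>a\<in>out_arcs G v. complex_of_real ((if head G a \<in> S then y (head G a) else 0) / sqrt Y))"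
      unfolding adjacency_op_def f_def by (intro sum.cong) auto
    then show ?thesis by (simp add: g_def sum_divide_distrib)
  qed
  have "((\<Sum>v\<in>S. y v * g v) / Y)\<^sup>2 = (\<Sum>v\<in>S. (y v / sqrt Y) * (g v / sqrt Y))\<^sup>2"
    using Y by (simp add: sum_divide_distrib)
  also have "\<dots> \<le> (\<Sum>v\<in>S. (y v / sqrt Y)\<^sup>2) * (\<Sum>v\<in>S. (g v / sqrt Y)\<^sup>2)"
    by (rule Cauchy_Schwarz_ineq_sum)
  also have "\<dots> = (\<Sum>v\<in>S. (cmod (adjacency_op G f v))\<^sup>2)"
    unfolding normalized Af norm_of_real power2_abs by simp
  also have "\<dots> \<le> (ell2_norm (verts G) (adjacency_op G f))\<^sup>2"
    using adjacency_op_in_ell2(1)[OF f(1)] S by (rule sum_le_ell2_norm_square)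
  also have "\<dots> \<le> (rho G)\<^sup>2"
    using norm_adjacency_op_le_rho[OF f(1)] f(2) ell2_norm_nonneg by (intro power_mono) auto
  finally have "((\<Sum>v\<in>S. y v * g v) / Y)\<^sup>2 \<le> (rho G)\<^sup>2" .
  moreover have "0 \<le> rho G"
    using order.trans[OF ell2_norm_nonneg norm_adjacency_op_le_rho[OF f(1)]] f(2) by simp
  ultimately have "(\<Sum>v\<in>S. y v * g v) / Y \<le> rho G"
    by (rule power2_le_imp_le)
  then show ?thesis using Y by (simp add: field_simps Y_def g_def)
qed

text \<open>An isoperimetric inequality: cutting \<open>y\<close> off outside \<open>S\<close> loses
  exactly the boundary products in the quadratic form, so a gap between \<open>\<theta>\<close> and
  \<open>rho G\<close> forces every finite set to have a boundary comparable to its mass.\<close>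

lemma boundary_ge_if_eigenfunction:
  fixes y :: "'a \<Rightarrow> real"
  assumes S: "finite S" "S \<subseteq> verts G" "S \<noteq> {}" and y: "\<And>v. v \<in> verts G \<Longrightarrow> 0 < y v"
    and eig: "\<And>v. v \<in> verts G \<Longrightarrow> (\<Sum>a\<in>out_arcs G v. y (head G a)) = \<theta> * y v"
  shows "(\<theta> - rho G) * (\<Sum>v\<in>S. (y v)\<^sup>2) \<le>
    (\<Sum>a\<in>{a \<in> arcs G. tail G a \<in> S \<and> head G a \<notin> S}. y (tail G a) * y (head G a))"
proof -
  let ?B = "\<lambda>v. {a \<in> out_arcs G v. head G a \<notin> S}"
  have "(\<Sum>v\<in>S. (y v)\<^sup>2) > 0"
  proof (rule sum_pos)
    show "0 < (y v)\<^sup>2" if "v \<in> S" for v using y[of v] that S(2) by auto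
  qed (use S in auto)
  note Rayleigh_quotient_le_rho[OF S(1,2) this]
  moreover have "(\<Sum>v\<in>S. y v * (\<Sum>a\<in>out_arcs G v. if head G a \<in> S then y (head G a) else 0)) =
      (\<Sum>v\<in>S. \<theta> * (y v)\<^sup>2 - (\<Sum>a\<in>?B v. y (tail G a) * y (head G a)))"
  proof (rule sum.cong)
    fix v assume "v \<in> S"
    then have v: "v \<in> verts G" "finite (out_arcs G v)" using S locally_finite by auto
    have "(\<Sum>a\<in>out_arcs G v. if head G a \<in> S then y (head G a) else 0) =
        (\<Sum>a\<in>out_arcs G v. y (head G a)) - (\<Sum>a\<in>?B v. y (head G a))"
      unfolding sum.inter_filter[OF v(2)] sum_subtractf[symmetric] by (intro sum.cong) auto
    moreover have "(\<Sum>a\<in>?B v. y (tail G a) * y (head G a)) = y v * (\<Sum>a\<in>?B v. y (head G a))"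
      unfolding sum_distrib_left by (intro sum.cong) auto
    ultimately show "y v * (\<Sum>a\<in>out_arcs G v. if head G a \<in> S then y (head G a) else 0) =
        \<theta> * (y v)\<^sup>2 - (\<Sum>a\<in>?B v. y (tail G a) * y (head G a))"
      using eig[OF v(1)] by (simp add: right_diff_distrib power2_eq_square)
  qed simp
  moreover have "(\<Sum>v\<in>S. \<Sum>a\<in>?B v. y (tail G a) * y (head G a)) =
      (\<Sum>a\<in>{a \<in> arcs G. tail G a \<in> S \<and> head G a \<notin> S}. y (tail G a) * y (head G a))"
  proof -
    have "{a \<in> arcs G. tail G a \<in> S \<and> head G a \<notin> S} = (\<Union>v\<in>S. ?B v)" by auto
    moreover have "\<forall>v\<in>S. finite (?B v)"
    proof
      fix v assume "v \<in> S"
      then have "finite (out_arcs G v)" using S locally_finite by auto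
      then show "finite (?B v)" by (rule rev_finite_subset) blast
    qed
    moreover have "\<forall>v\<in>S. \<forall>w\<in>S. v \<noteq> w \<longrightarrow> ?B v \<inter> ?B w = {}" by auto
    ultimately show ?thesis using S(1) by (simp only: sum.UNION_disjoint)
  qed
  ultimately show ?thesis by (simp add: sum_subtractf sum_distrib_left[symmetric] algebra_simps)
qed

end

section \<open>Rooted trees\<close>

context bidirected_digraph begin

lemma reduced_closed_awalk_avoiding_feedback_edge:
  assumes feedback: "\<And>q. cycle q \<Longrightarrow> \<forall>a\<in>set q. arev a \<notin> set q \<Longrightarrow> a0 \<in> set q \<or> arev a0 \<in> set q"
    and "awalk u p u" "reduced p" "a0 \<notin> set p" "arev a0 \<notin> set p"
  shows "p = []"
proof (rule ccontr)
  assume "p \<noteq> []"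
  then obtain q where "cycle q" "set q \<subseteq> set p" "\<forall>a\<in>set q. arev a \<notin> set q"
    using reduced_closed_awalk_contains_cycle[OF assms(2,3)] by blast
  then show False using feedback[of q] assms(4,5) by blast
qed

text \<open>Consider a shortest stretch from an arc \<open>e\<close> of this edge to its reverse.
  The part \<open>m\<close> in between is a reduced closed walk; if it avoids the edge it is empty,
  and \<open>arev e\<close> directly after \<open>e\<close> is not reduced. If it meets the edge,
  there is a shorter stretch.\<close>

lemma reduced_awalk_not_both_directions:
  assumes feedback: "\<And>q. cycle q \<Longrightarrow> \<forall>a\<in>set q. arev a \<notin> set q \<Longrightarrow> a0 \<in> set q \<or> arev a0 \<in> set q"
    and walk: "awalk u p v" "reduced p"
  shows "\<not> (a0 \<in> set p \<and> arev a0 \<in> set p)"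
proof
  have no_return: False
    if "awalk u (e # m @ [arev e]) v" "reduced (e # m @ [arev e])" "e = a0 \<or> e = arev a0"
    for u e m v
    using that
  proof (induction "length m" arbitrary: u v m rule: less_induct)
    case less
    have e: "e \<in> arcs G" "awalk (head G e) m (head G e)" and m: "reduced m"
      using less.prems by (auto simp: awalk_simps reduced_Cons_iff reduced_append_iff)
    show False
    proof (cases "e \<in> set m \<or> arev e \<in> set m")
      case False
      then have "m = []"
        using reduced_closed_awalk_avoiding_feedback_edge[OF feedback e(2) m] less.prems(3) by auto
      then show False using less.prems(2) by (simp add: reduced_Cons_iff)
    next
      case True
      then show False
      proof
        assume "e \<in> set m"
        then obtain m1 m2 where m: "m = m1 @ e # m2" by (auto dest: split_list)
        have "awalk (tail G e) (e # m2 @ [arev e]) v" "reduced (e # m2 @ [arev e])"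
          using less.prems(1,2) unfolding m
          by (auto simp: awalk_simps reduced_Cons_iff reduced_append_iff)
        then show False using less.hyps[of m2] less.prems(3) m by auto
      next
        assume "arev e \<in> set m"
        then obtain m1 m2 where m: "m = m1 @ arev e # m2" by (auto dest: split_list)
        have "awalk u (e # m1 @ [arev e]) (head G (arev e))" "reduced (e # m1 @ [arev e])"
          using less.prems(1,2) unfolding m
          by (auto simp: awalk_simps reduced_Cons_iff reduced_append_iff hd_append split: if_splits)
        then show False using less.hyps[of m1] less.prems(3) m by auto
      qed
    qed
  qed
  assume both: "a0 \<in> set p \<and> arev a0 \<in> set p"
  then have "a0 \<in> arcs G" using walk(1) by auto
  then have "arev a0 \<noteq> a0" by (rule arev_neq)
  obtain p1 p2 where p: "p = p1 @ a0 # p2" using both by (auto dest: split_list)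
  have "arev a0 \<in> set p1 \<or> arev a0 \<in> set p2"
    using both \<open>arev a0 \<noteq> a0\<close> by (auto simp: p)
  then obtain e q1 m q2 where e: "e = a0 \<or> e = arev a0" and q: "p = q1 @ (e # m @ [arev e]) @ q2"
  proof
    assume "arev a0 \<in> set p1"
    then obtain l1 l2 where "p1 = l1 @ arev a0 # l2" by (auto dest: split_list)
    then show thesis using p by (intro that[of "arev a0" l1 l2 p2]) auto
  next
    assume "arev a0 \<in> set p2"
    then obtain l1 l2 where "p2 = l1 @ arev a0 # l2" by (auto dest: split_list)
    then show thesis using p by (intro that[of "a0" p1 l1 l2]) auto
  qed
  have "\<exists>u' v'. awalk u' (e # m @ [arev e]) v'"
    using walk(1) unfolding q awalk_append_iff by blast
  moreover have "reduced (e # m @ [arev e])"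
    using walk(2) unfolding q by (simp only: reduced_append_iff[of q1] reduced_append_iff[of _ q2])
  ultimately show False using no_return e by blast
qed

end

section \<open>Root paths and the orientation away from the root\<close>

locale rooted_tree = bidirected_digraph G arev
  for G :: "('a, 'b) pre_digraph" and arev :: "'b \<Rightarrow> 'b" +
  fixes root :: 'a
  assumes connected: "Digraph_Component.connected G"
    and acyclic: "cycles G arev = {}"
    and root: "root \<in> verts G"
begin

definition path :: "'a \<Rightarrow> 'b awalk" where
  "path v = (SOME p. awalk root p v \<and> reduced p)"

lemma path:
  assumes "v \<in> verts G"
  shows "awalk root (path v) v" "reduced (path v)"
proof -
  obtain p where "apath root p v" using connected_imp_apath[OF connected root assms] by blast
  then have "awalk root p v \<and> reduced p" by (simp add: awalkI_apath apath_imp_reduced)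
  then have "awalk root (path v) v \<and> reduced (path v)" unfolding path_def by (rule someI)
  then show "awalk root (path v) v" "reduced (path v)" by auto
qed

lemma path_unique: "awalk root p v \<Longrightarrow> reduced p \<Longrightarrow> p = path v"
  using reduced_awalk_unique[OF acyclic] path awalk_last_in_verts by blast

lemma path_root: "path root = []"
  using path_unique[of "[]" root] root by (simp add: awalk_Nil_iff)

text \<open>Appending \<open>a\<close> to the root path of its tail either keeps it reduced or
  backtracks along its last arc, which is then dropped; uniqueness identifies the result.\<close>

lemma path_step:
  assumes "a \<in> arcs G"
  shows "path (head G a) = path (tail G a) @ [a] \<or> path (tail G a) = path (head G a) @ [arev a]"
proof (cases "reduced (path (tail G a) @ [a])")
  case True
  have "awalk root (path (tail G a) @ [a]) (head G a)"
    using path(1)[of "tail G a"] assms by (auto simp: awalk_simps)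
  then show ?thesis using path_unique True by metis
next
  case False
  have red: "reduced (path (tail G a))" using path(2) assms by simp
  then have "path (tail G a) \<noteq> []" "a = arev (last (path (tail G a)))"
    using False by (auto simp: reduced_append_iff reduced_Cons_iff)
  then obtain p where p: "path (tail G a) = p @ [arev a]"
    by (metis append_butlast_last_id arev_arev)
  have "awalk root (p @ [arev a]) (tail G a)" using path(1)[of "tail G a"] assms p by simp
  then have "awalk root p (head G a)" using assms by (auto simp: awalk_simps)
  moreover have "reduced p" using red p by (simp add: reduced_append_iff)
  ultimately have "p = path (head G a)" by (rule path_unique)
  then show ?thesis using p by simp
qed

definition away :: "'b \<Rightarrow> bool" where
  "away a \<longleftrightarrow> path (head G a) = path (tail G a) @ [a]"

lemma away_arev:
  assumes "a \<in> arcs G"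
  shows "away (arev a) \<longleftrightarrow> \<not> away a"
proof
  assume "away (arev a)"
  then have "length (path (tail G a)) = Suc (length (path (head G a)))"
    using assms by (simp add: away_def)
  then show "\<not> away a" by (auto simp: away_def)
next
  assume "\<not> away a"
  then show "away (arev a)" using path_step[OF assms] assms by (simp add: away_def)
qed

lemma away_if_tail_root:
  assumes "a \<in> out_arcs G root"
  shows "away a"
  using path_step[of a] assms by (auto simp: away_def path_root)

text \<open>The arc is the reverse of the last arc on the root path of \<open>v\<close>.\<close>

lemma unique_arc_towards_root:
  assumes "v \<in> verts G" "v \<noteq> root"
  shows "\<exists>b\<in>out_arcs G v. \<not> away b \<and> (\<forall>a\<in>out_arcs G v - {b}. away a)"
proof -
  have "path v \<noteq> []" using path(1)[OF assms(1)] assms(2) by (auto simp: awalk_Nil_iff)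
  then obtain p e where p: "path v = p @ [e]" by (metis append_butlast_last_id)
  have e: "e \<in> arcs G" "head G e = v" and "awalk root p (tail G e)"
    using path(1)[OF assms(1)] unfolding p by (auto simp: awalk_simps)
  moreover have "reduced p" using path(2)[OF assms(1)] unfolding p by (simp add: reduced_append_iff)
  ultimately have "p = path (tail G e)" by (intro path_unique)
  then have "away e" using e p by (simp add: away_def)
  moreover have "away a" if "a \<in> out_arcs G v" "a \<noteq> arev e" for a
  proof (rule ccontr)
    assume "\<not> away a"
    then have "path v = path (head G a) @ [arev a]"
      using path_step[of a] that by (auto simp: away_def)
    then have "arev a = e" using p by simp
    then show False using that(2) by auto
  qed
  ultimately show ?thesis
    using e away_arev[of e] by (intro bexI[of _ "arev e"]) auto
qed

end

section \<open>Covers by trees\<close>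

locale tree_cover = G: bidirected_digraph G r + T: rooted_tree T s root
  for G :: "('v, 'e) pre_digraph" and r :: "'e \<Rightarrow> 'e"
    and T :: "('w, 'f) pre_digraph" and s :: "'f \<Rightarrow> 'f" and root :: 'w +
  fixes \<pi>v :: "'w \<Rightarrow> 'v" and \<pi>e :: "'f \<Rightarrow> 'e"
  assumes finite_base: "fin_digraph G"
    and connected_base: "Digraph_Component.connected G"
    and hom: "graph_hom T s G r \<pi>v \<pi>e"
    and star: "\<And>v. v \<in> verts T \<Longrightarrow> bij_betw \<pi>e (out_arcs T v) (out_arcs G (\<pi>v v))"

sublocale tree_cover \<subseteq> G: fin_digraph G
  by (rule finite_base)

context tree_cover begin

lemma \<pi>v_in_verts: "v \<in> verts T \<Longrightarrow> \<pi>v v \<in> verts G"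
  using hom by (simp add: graph_hom_def)

lemma \<pi>e:
  assumes "a \<in> arcs T"
  shows "\<pi>e a \<in> arcs G" "tail G (\<pi>e a) = \<pi>v (tail T a)" "head G (\<pi>e a) = \<pi>v (head T a)"
    "\<pi>e (s a) = r (\<pi>e a)"
  using hom assms by (auto simp: graph_hom_def)

lemma finite_out_arcs_cover: "v \<in> verts T \<Longrightarrow> finite (out_arcs T v)"
  using bij_betw_finite[OF star] by blast

lemma \<pi>e_eq_iff:
  assumes "a \<in> arcs T" "b \<in> arcs T" "tail T a = tail T b"
  shows "\<pi>e a = \<pi>e b \<longleftrightarrow> a = b"
  using bij_betw_imp_inj_on[OF star[of "tail T a"]] assms
  by (auto simp: inj_on_def)

lemma sum_star:
  "v \<in> verts T \<Longrightarrow> (\<Sum>a\<in>out_arcs T v. f (\<pi>e a)) = (\<Sum>a\<in>out_arcs G (\<pi>v v). f a)"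
  by (rule sum.reindex_bij_betw[OF star])

lemma awalk_project: "T.awalk u p v \<Longrightarrow> G.awalk (\<pi>v u) (map \<pi>e p) (\<pi>v v)"
proof (induction p arbitrary: u)
  case Nil
  then show ?case by (auto simp: T.awalk_Nil_iff G.awalk_Nil_iff \<pi>v_in_verts)
next
  case (Cons a p)
  then show ?case by (simp add: T.awalk_Cons_iff G.awalk_Cons_iff \<pi>e)
qed

text \<open>Local injectivity: if the images of consecutive arcs \<open>a\<close>, \<open>b\<close>
  backtrack, then \<open>b\<close> and \<open>s a\<close> leave the same vertex with the same image,
  so they agree.\<close>

lemma reduced_project:
  assumes "T.awalk u p v" "T.reduced p"
  shows "G.reduced (map \<pi>e p)"
  using assms
proof (induction p arbitrary: u)
  case (Cons a p)
  show ?case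
  proof (cases p)
    case (Cons b q)
    have ab: "a \<in> arcs T" "b \<in> arcs T" "tail T b = head T a" "b \<noteq> s a" "T.reduced p"
      "T.awalk (head T a) p v"
      using Cons.prems Cons by (auto simp: T.awalk_Cons_iff T.reduced_Cons_iff)
    have "\<pi>e b \<noteq> r (\<pi>e a)"
      using \<pi>e_eq_iff[of b "s a"] ab \<pi>e(4)[of a] by simp
    then show ?thesis
      using Cons.IH[OF ab(6,5)] Cons by (simp add: G.reduced_Cons_iff)
  qed (simp add: G.reduced_Cons_iff)
qed simp

text \<open>
  Arcs leading away from the root get the weight \<open>\<phi>\<close> of their projection, arcs leading back the inverse
  weight of their reversal; so \<open>b\<close> below is the projection of the arc through which a vertex other
  than the root is reached.
\<close>

lemma rho_le_if_arc_weights: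
  assumes pos: "\<And>b. b \<in> arcs G \<Longrightarrow> 0 < \<phi> b"
    and at_root: "\<And>v. v \<in> verts G \<Longrightarrow> (\<Sum>a\<in>out_arcs G v. \<phi> a) \<le> K"
    and elsewhere: "\<And>b. b \<in> arcs G \<Longrightarrow>
      1 / \<phi> b + (\<Sum>a\<in>out_arcs G (head G b) - {r b}. \<phi> a) \<le> K"
  shows "rho T \<le> K"
proof -
  define c where "c a = (if T.away a then \<phi> (\<pi>e a) else 1 / \<phi> (\<pi>e (s a)))" for a
  have "weighted_bidirected_digraph T s c K"
  proof
    show "0 < c a" if "a \<in> arcs T" for a
      using that pos \<pi>e(1) by (simp add: c_def)
    show "c a * c (s a) = 1" if "a \<in> arcs T" for a
      using pos[OF \<pi>e(1)[OF that]] pos[OF \<pi>e(1)[of "s a"]] T.away_arev[OF that] that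
      by (simp add: c_def)
    show "(\<Sum>a\<in>out_arcs T v. c a) \<le> K" if v: "v \<in> verts T" for v
    proof (cases "v = root")
      case True
      then have "(\<Sum>a\<in>out_arcs T v. c a) = (\<Sum>a\<in>out_arcs T v. \<phi> (\<pi>e a))"
        using T.away_if_tail_root by (intro sum.cong) (auto simp: c_def)
      then show ?thesis using sum_star[OF v, of \<phi>] at_root[OF \<pi>v_in_verts[OF v]] by simp
    next
      case False
      then obtain b where b: "b \<in> out_arcs T v" "\<not> T.away b"
        "\<And>a. a \<in> out_arcs T v - {b} \<Longrightarrow> T.away a"
        using T.unique_arc_towards_root[OF v] by blast
      \<comment> \<open>\<open>s b\<close> is the last arc on the root path of \<open>v\<close>, so
        \<open>?e\<close> is the arc to which \<open>elsewhere\<close> is applied.\<close>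
      let ?e = "\<pi>e (s b)"
      have arc: "b \<in> arcs T" "tail T b = v" using b(1) by auto
      then have e: "?e \<in> arcs G" "head G ?e = \<pi>v v" "r ?e = \<pi>e b"
        using \<pi>e[of "s b"] \<pi>e(4)[of b] by simp_all
      have "(\<Sum>a\<in>out_arcs T v. c a) = c b + (\<Sum>a\<in>out_arcs T v - {b}. c a)"
        by (rule sum.remove[OF finite_out_arcs_cover[OF v] b(1)])
      also have "(\<Sum>a\<in>out_arcs T v - {b}. c a) = (\<Sum>a\<in>out_arcs T v - {b}. \<phi> (\<pi>e a))"
        using b(3) by (intro sum.cong) (auto simp: c_def)
      also have "\<dots> = (\<Sum>a\<in>out_arcs G (\<pi>v v) - {\<pi>e b}. \<phi> a)"
        by (rule sum.reindex_bij_betw[OF bij_betw_DiffI[OF star[OF v]]])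
          (use arc \<pi>e[OF arc(1)] in \<open>auto simp: bij_betw_def\<close>)
      also have "c b + \<dots> = 1 / \<phi> ?e + (\<Sum>a\<in>out_arcs G (head G ?e) - {r ?e}. \<phi> a)"
        using b(2) e by (simp add: c_def)
      also have "\<dots> \<le> K" by (rule elsewhere[OF e(1)])
      finally show ?thesis .
    qed
    have "0 \<le> (\<Sum>a\<in>out_arcs G (\<pi>v root). \<phi> a)"
      using pos by (intro sum_nonneg) (auto simp: less_imp_le)
    then show "0 \<le> K" using at_root[OF \<pi>v_in_verts[OF T.root]] by linarith
  qed (rule finite_out_arcs_cover)
  then show ?thesis by (rule weighted_bidirected_digraph.rho_le)
qed

end

section \<open>Lifted eigenvectors\<close>

locale tree_cover_eigenvector = tree_cover +
  fixes x :: "'a \<Rightarrow> real" and ev :: real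
  assumes x_pos: "\<And>v. v \<in> verts G \<Longrightarrow> 0 < x v"
    and x_eig: "\<And>v. v \<in> verts G \<Longrightarrow> (\<Sum>a\<in>out_arcs G v. x (head G a)) = ev * x v"
begin

lemma lift_pos: "v \<in> verts T \<Longrightarrow> 0 < x (\<pi>v v)"
  by (simp add: x_pos \<pi>v_in_verts)

lemma lift_eig:
  assumes "v \<in> verts T"
  shows "(\<Sum>a\<in>out_arcs T v. x (\<pi>v (head T a))) = ev * x (\<pi>v v)"
proof -
  have "(\<Sum>a\<in>out_arcs T v. x (\<pi>v (head T a))) = (\<Sum>a\<in>out_arcs T v. x (head G (\<pi>e a)))"
    by (intro sum.cong) (auto simp: \<pi>e)
  also have "\<dots> = ev * x (\<pi>v v)"
    using sum_star[OF assms, of "\<lambda>a. x (head G a)"] x_eig[OF \<pi>v_in_verts[OF assms]] by simp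
  finally show ?thesis .
qed

lemma weighted_by_lift:
  "weighted_bidirected_digraph T s (\<lambda>a. x (\<pi>v (head T a)) / x (\<pi>v (tail T a))) ev"
proof
  show "0 < x (\<pi>v (head T a)) / x (\<pi>v (tail T a))" if "a \<in> arcs T" for a
    using that lift_pos by simp
  show "x (\<pi>v (head T a)) / x (\<pi>v (tail T a)) *
      (x (\<pi>v (head T (s a))) / x (\<pi>v (tail T (s a)))) = 1" if "a \<in> arcs T" for a
    using lift_pos[of "head T a"] lift_pos[of "tail T a"] that by simp
  show "(\<Sum>a\<in>out_arcs T v. x (\<pi>v (head T a)) / x (\<pi>v (tail T a))) \<le> ev" if v: "v \<in> verts T" for v
  proof -
    have "(\<Sum>a\<in>out_arcs T v. x (\<pi>v (head T a)) / x (\<pi>v (tail T a))) =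
        (\<Sum>a\<in>out_arcs T v. x (\<pi>v (head T a))) / x (\<pi>v v)"
      unfolding sum_divide_distrib by (intro sum.cong) auto
    then show ?thesis using lift_eig[OF v] lift_pos[OF v] by simp
  qed
  have "0 \<le> (\<Sum>a\<in>out_arcs T root. x (\<pi>v (head T a)))"
    using lift_pos by (intro sum_nonneg) (auto simp: less_imp_le)
  then show "0 \<le> ev"
    using lift_eig[OF T.root] lift_pos[OF T.root] by (simp add: zero_le_mult_iff)
qed (rule finite_out_arcs_cover)

lemma rho_le_eigenvalue: "rho T \<le> ev"
  by (rule weighted_bidirected_digraph.rho_le[OF weighted_by_lift])

end

text \<open>
  Every cycle of the base runs through the edge of \<open>a0\<close>. If the base is acyclic, \<open>a0\<close> need not even
  be an arc; the edge then plays no role.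
\<close>

locale tree_cover_feedback = tree_cover_eigenvector +
  fixes a0 :: 'b
  assumes feedback: "\<And>q. G.cycle q \<Longrightarrow> \<forall>a\<in>set q. r a \<notin> set q \<Longrightarrow> a0 \<in> set q \<or> r a0 \<in> set q"
begin

definition sign :: "'b \<Rightarrow> int" where
  "sign a = (if a = a0 then 1 else if a = r a0 then - 1 else 0)"

lemma sign_r: "a \<in> arcs G \<Longrightarrow> sign (r a) = - sign a"
  using G.arev_neq[of a] by (auto simp: sign_def G.arev_eq_iff)

text \<open>The net number of crossings of the lifts of \<open>a0\<close> on the way from the root.\<close>

definition height :: "'c \<Rightarrow> int" where
  "height v = (\<Sum>a\<leftarrow>T.path v. sign (\<pi>e a))"

lemma height_step:
  assumes "a \<in> arcs T"
  shows "height (head T a) = height (tail T a) + sign (\<pi>e a)"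
  using T.path_step[OF assms] sign_r[OF \<pi>e(1)[OF assms]] \<pi>e(4)[OF assms]
  by (auto simp: height_def)

lemma height_awalk:
  "T.awalk u p v \<Longrightarrow> height v = height u + (\<Sum>a\<leftarrow>p. sign (\<pi>e a))"
proof (induction p arbitrary: u)
  case (Cons a p)
  then have "a \<in> arcs T" "u = tail T a" "T.awalk (head T a) p v" by (auto simp: T.awalk_Cons_iff)
  then show ?case using Cons.IH height_step by auto
qed (simp add: T.awalk_Nil_iff)

text \<open>A reduced walk crosses the edge of \<open>a0\<close> in one direction only, so its signs
  cannot cancel. Sum zero means no crossing, and then no cycle is available.\<close>

lemma reduced_closed_awalk_sign_sum:
  assumes "G.awalk u p u" "G.reduced p" "(\<Sum>a\<leftarrow>p. sign a) = 0"
  shows "p = []"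
proof -
  have "\<not> (a0 \<in> set p \<and> r a0 \<in> set p)"
    using G.reduced_awalk_not_both_directions[OF feedback assms(1,2)] by blast
  moreover have "a0 \<notin> set p" if "r a0 \<notin> set p"
  proof
    assume "a0 \<in> set p"
    have "(\<Sum>a\<leftarrow>p. sign a) > 0" if "a0 \<in> set p" "r a0 \<notin> set p" for p
      using that
    proof (induction p)
      case (Cons b p)
      have "0 \<le> (\<Sum>a\<leftarrow>p. sign a)"
        using Cons.prems by (intro sum_list_nonneg) (auto simp: sign_def)
      moreover have "0 \<le> sign b" "sign a0 = 1" using Cons.prems by (auto simp: sign_def)
      ultimately show ?case using Cons by (cases "a0 \<in> set p") auto
    qed simp
    from this[OF \<open>a0 \<in> set p\<close> that] show False using assms(3) by simp
  qed
  moreover have "r a0 \<notin> set p" if "a0 \<notin> set p"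
  proof
    assume "r a0 \<in> set p"
    have "(\<Sum>a\<leftarrow>p. sign a) < 0" if "r a0 \<in> set p" "a0 \<notin> set p" for p
      using that
    proof (induction p)
      case (Cons b p)
      have "(\<Sum>a\<leftarrow>p. sign a) \<le> 0"
        using Cons.prems by (intro sum_list_nonpos) (auto simp: sign_def)
      then show ?case using Cons by (cases "r a0 \<in> set p") (auto simp: sign_def)
    qed simp
    from this[OF \<open>r a0 \<in> set p\<close> that] show False using assms(3) by simp
  qed
  ultimately have "a0 \<notin> set p" "r a0 \<notin> set p" by blast+
  then show ?thesis
    using G.reduced_closed_awalk_avoiding_feedback_edge[OF feedback assms(1,2)] by blast
qed

text \<open>The path from \<open>u\<close> to \<open>v\<close> projects to a reduced closed walk
  whose sign sum is the difference of the heights.\<close>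

lemma vertex_determined_by_height:
  assumes "u \<in> verts T" "v \<in> verts T" "\<pi>v u = \<pi>v v" "height u = height v"
  shows "u = v"
proof -
  obtain p where p: "T.apath u p v" using T.connected_imp_apath[OF T.connected assms(1,2)] by blast
  then have walk: "T.awalk u p v" "T.reduced p"
    by (simp_all add: T.awalkI_apath T.apath_imp_reduced)
  have "(\<Sum>a\<leftarrow>map \<pi>e p. sign a) = 0"
    using height_awalk[OF walk(1)] assms(4) by (simp add: comp_def)
  then have "map \<pi>e p = []"
    using awalk_project[OF walk(1)] reduced_project[OF walk] assms(3)
    by (intro reduced_closed_awalk_sign_sum) auto
  then show ?thesis using walk(1) by (simp add: T.awalk_Nil_iff)
qed

definition slab :: "nat \<Rightarrow> 'c set" where
  "slab n = {v \<in> verts T. \<bar>height v\<bar> \<le> int n}"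

lemma finite_slab: "finite (slab n)"
proof (rule inj_on_finite)
  show "inj_on (\<lambda>v. (\<pi>v v, height v)) (slab n)"
    by (auto simp: inj_on_def slab_def intro: vertex_determined_by_height)
  show "(\<lambda>v. (\<pi>v v, height v)) ` slab n \<subseteq> verts G \<times> {- int n..int n}"
    using \<pi>v_in_verts by (auto simp: slab_def)
qed auto

text \<open>A boundary arc changes the height, so it lies over \<open>a0\<close> and leaves height
  \<open>n\<close>, or over \<open>r a0\<close> and leaves height \<open>- n\<close>. Its projection
  thus fixes the height of its tail, and with it the tail and the arc.\<close>

lemma boundary_slab:
  fixes n defines "B \<equiv> {a \<in> arcs T. tail T a \<in> slab n \<and> head T a \<notin> slab n}"
  shows "card B \<le> 2"
proof -
  have "inj_on \<pi>e B"
  proof (rule inj_onI)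
    fix a b assume ab: "a \<in> B" "b \<in> B" "\<pi>e a = \<pi>e b"
    then have arcs: "a \<in> arcs T" "b \<in> arcs T" by (auto simp: B_def)
    have "height (tail T a) = height (tail T b)"
      using ab height_step[OF arcs(1)] height_step[OF arcs(2)]
      by (auto simp: B_def slab_def sign_def split: if_splits)
    moreover have "\<pi>v (tail T a) = \<pi>v (tail T b)" using \<pi>e(2) arcs ab(3) by metis
    ultimately have "tail T a = tail T b"
      using arcs by (intro vertex_determined_by_height) auto
    then show "a = b" using \<pi>e_eq_iff arcs ab(3) by blast
  qed
  moreover have "\<pi>e ` B \<subseteq> {a0, r a0}"
  proof
    fix e assume "e \<in> \<pi>e ` B"
    then obtain a where "a \<in> B" "e = \<pi>e a" by blast
    then show "e \<in> {a0, r a0}"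
      using height_step[of a] by (auto simp: B_def slab_def sign_def split: if_splits)
  qed
  ultimately have "card B \<le> card {a0, r a0}" by (intro card_inj_on_le) auto
  also have "\<dots> \<le> 2" by (simp add: card_insert_if)
  finally show ?thesis .
qed

lemma finite_subset_slab:
  assumes "finite F" "F \<subseteq> verts T"
  shows "\<exists>n. F \<subseteq> slab n"
proof -
  define n where "n = (\<Sum>v\<in>F. nat \<bar>height v\<bar>)"
  have "nat \<bar>height v\<bar> \<le> n" if "v \<in> F" for v
    unfolding n_def using assms(1) that by (intro member_le_sum) auto
  then have "F \<subseteq> slab n" using assms(2) by (auto simp: slab_def nat_le_iff)
  then show ?thesis by blast
qed

text \<open>With a positive gap, the two boundary arcs would bound the mass of every slab by a
  constant. As slabs exhaust \<open>T\<close>, the tree would be finite, hence itself a slab with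
  positive mass and empty boundary.\<close>

lemma eigenvalue_le_rho: "ev \<le> rho T"
proof (rule ccontr)
  assume "\<not> ev \<le> rho T"
  then have gap: "0 < ev - rho T" by simp
  \<comment> \<open>Bounds that hold uniformly on \<open>T\<close>, since the lift only takes values
    of \<open>x\<close> on the finite base.\<close>
  define m where "m = Min (x ` verts G)"
  define M where "M = Max (x ` verts G)"
  have "verts G \<noteq> {}" using \<pi>v_in_verts[OF T.root] by blast
  then have m: "0 < m" "\<And>v. v \<in> verts G \<Longrightarrow> m \<le> x v" and M: "\<And>v. v \<in> verts G \<Longrightarrow> x v \<le> M"
    using x_pos by (auto simp: m_def M_def)
  have M0: "0 \<le> M"
    using lift_pos[OF T.root] M[OF \<pi>v_in_verts[OF T.root]] by linarith
  let ?B = "\<lambda>S. {a \<in> arcs T. tail T a \<in> S \<and> head T a \<notin> S}"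
  have root: "root \<in> slab n" for n
    using T.root by (simp add: slab_def height_def T.path_root)
  have boundary: "(ev - rho T) * (\<Sum>v\<in>slab n. (x (\<pi>v v))\<^sup>2) \<le>
      (\<Sum>a\<in>?B (slab n). x (\<pi>v (tail T a)) * x (\<pi>v (head T a)))" for n
    using finite_slab root
    by (intro weighted_bidirected_digraph.boundary_ge_if_eigenfunction[OF weighted_by_lift])
      (auto simp: slab_def lift_pos lift_eig)
  have sum_ge: "m\<^sup>2 * card (slab n) \<le> (\<Sum>v\<in>slab n. (x (\<pi>v v))\<^sup>2)" for n
  proof -
    have "m\<^sup>2 * card (slab n) = (\<Sum>v\<in>slab n. m\<^sup>2)" by simp
    also have "\<dots> \<le> (\<Sum>v\<in>slab n. (x (\<pi>v v))\<^sup>2)"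
      using m \<pi>v_in_verts by (intro sum_mono power_mono) (auto simp: slab_def)
    finally show ?thesis .
  qed
  have card_slab: "(ev - rho T) * m\<^sup>2 * card (slab n) \<le> 2 * M\<^sup>2" for n
  proof -
    have "(ev - rho T) * (m\<^sup>2 * card (slab n)) \<le> (ev - rho T) * (\<Sum>v\<in>slab n. (x (\<pi>v v))\<^sup>2)"
      using gap sum_ge by (intro mult_left_mono) auto
    also note boundary
    also have "(\<Sum>a\<in>?B (slab n). x (\<pi>v (tail T a)) * x (\<pi>v (head T a))) \<le> (\<Sum>a\<in>?B (slab n). M * M)"
      using M M0 \<pi>v_in_verts lift_pos by (intro sum_mono mult_mono) (auto simp: less_imp_le)
    also have "\<dots> \<le> 2 * M\<^sup>2"
      using boundary_slab[of n] by (simp add: power2_eq_square mult_right_mono)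
    finally show ?thesis by (simp add: mult.assoc)
  qed
  have "finite (verts T)"
  proof (rule ccontr)
    assume inf: "infinite (verts T)"
    obtain N :: nat where N: "2 * M\<^sup>2 / ((ev - rho T) * m\<^sup>2) < N"
      using reals_Archimedean2 by blast
    obtain F where F: "finite F" "F \<subseteq> verts T" "card F = N"
      using infinite_arbitrarily_large[OF inf] by blast
    obtain n where "F \<subseteq> slab n" using finite_subset_slab F by blast
    then have "N \<le> card (slab n)" using F(3) card_mono[OF finite_slab] by blast
    then have "2 * M\<^sup>2 / ((ev - rho T) * m\<^sup>2) < card (slab n)" using N by linarith
    moreover have "0 < (ev - rho T) * m\<^sup>2" using gap m(1) by simp
    ultimately have "2 * M\<^sup>2 < (ev - rho T) * m\<^sup>2 * card (slab n)"
      by (simp add: pos_divide_less_eq mult.commute)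
    then show False using card_slab[of n] by simp
  qed
  then obtain n where "verts T \<subseteq> slab n" using finite_subset_slab by blast
  then have empty: "?B (slab n) = {}" by auto
  have "(ev - rho T) * (\<Sum>v\<in>slab n. (x (\<pi>v v))\<^sup>2) \<le> 0"
    using boundary[of n] unfolding empty by simp
  moreover have "0 < card (slab n)"
    using root[of n] finite_slab[of n] by (metis card_gt_0_iff empty_iff)
  then have "0 < m\<^sup>2 * card (slab n)" using m(1) by simp
  then have "0 < (\<Sum>v\<in>slab n. (x (\<pi>v v))\<^sup>2)" using sum_ge[of n] by linarith
  ultimately show False using gap by (simp add: mult_le_0_iff)
qed

end

section \<open>Strict inequality when edges outnumber vertices\<close>

text \<open>Provides the hypotheses of \<open>rho_le_if_arc_weights\<close> with \<open>K\<close>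
  below \<open>ev\<close>. The perturbation lowers the star sum at \<open>v\<close> by
  \<open>t * m / (x v)\<^sup>2\<close>, while replacing the weight of \<open>arev b\<close> by
  \<open>1 / \<phi> b\<close> costs only \<open>t * (2 * n) / (x v)\<^sup>2\<close> to first order,
  where \<open>v\<close> is the head of \<open>b\<close>.\<close>

lemma (in bidirected_digraph) exists_subcritical_arc_weights:
  fixes x :: "'a \<Rightarrow> real"
  assumes "fin_digraph G" "Digraph_Component.connected G"
    and x_pos: "\<And>v. v \<in> verts G \<Longrightarrow> 0 < x v"
    and x_eig: "\<And>v. v \<in> verts G \<Longrightarrow> (\<Sum>a\<in>out_arcs G v. x (head G a)) = ev * x v"
    and many_arcs: "2 * card (verts G) < card (arcs G)"
  shows "\<exists>\<phi> K. K < ev \<and> (\<forall>b\<in>arcs G. 0 < \<phi> b) \<and> (\<forall>v\<in>verts G. (\<Sum>a\<in>out_arcs G v. \<phi> a) \<le> K) \<and>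
    (\<forall>b\<in>arcs G. 1 / \<phi> b + (\<Sum>a\<in>out_arcs G (head G b) - {arev b}. \<phi> a) \<le> K)"
proof -
  interpret fin_digraph G by fact
  define n where "n = real (card (verts G))"
  define m where "m = real (card (arcs G))"
  have d: "0 < m - 2 * n" and m: "0 < m" using many_arcs by (auto simp: n_def m_def)
  \<comment> \<open>\<open>\<theta>\<close> is the first-order perturbation: antisymmetric up to the constant \<open>2 * n\<close> per edge, and with
    net outflow \<open>m\<close> at every vertex. These totals are compatible, and \<open>m > 2 * n\<close> is the gain.\<close>
  have "(\<Sum>v\<in>verts G. m - n * card (out_arcs G v)) = n * m - n * (\<Sum>v\<in>verts G. card (out_arcs G v))"
    by (simp add: sum_subtractf sum_distrib_left n_def)
  also have "(\<Sum>v\<in>verts G. card (out_arcs G v)) = card (arcs G)"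
    using sum_out_arcs[of "\<lambda>_. 1 :: nat"] by simp
  finally have "(\<Sum>v\<in>verts G. m - n * card (out_arcs G v)) = 0" by (simp add: m_def)
  then obtain \<eta> where \<eta>: "\<And>a. a \<in> arcs G \<Longrightarrow> \<eta> (arev a) = - \<eta> a"
    "\<And>w. w \<in> verts G \<Longrightarrow> (\<Sum>a\<in>out_arcs G w. \<eta> a) = m - n * card (out_arcs G w)"
    using exists_flow[OF assms(1,2), of "\<lambda>v. m - n * card (out_arcs G v)"] by blast
  define \<theta> where "\<theta> a = n + \<eta> a" for a
  have \<theta>_arev: "\<theta> (arev a) = 2 * n - \<theta> a" if "a \<in> arcs G" for a
    using \<eta>(1)[OF that] by (simp add: \<theta>_def)
  have \<theta>_sum: "(\<Sum>a\<in>out_arcs G w. \<theta> a) = m" if "w \<in> verts G" for w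
    using \<eta>(2)[OF that] by (simp add: \<theta>_def sum.distrib)
  define P where "P a = x (tail G a) * x (head G a)" for a
  have P: "0 < P a" if "a \<in> arcs G" for a using that x_pos by (simp add: P_def)
  \<comment> \<open>The first condition keeps the numerators of \<open>\<phi>\<close> above
    \<open>P b / 2\<close>; given this, the second makes the quadratic error of
    \<open>1 / \<phi> b\<close> smaller than the linear gain \<open>t * (m - 2 * n)\<close>.\<close>
  have "\<forall>\<^sub>F t in at_right 0. \<forall>b\<in>arcs G. t * \<bar>\<theta> b\<bar> < P b / 2 \<and> t * (\<theta> b)\<^sup>2 < (m - 2 * n) * (P b / 2)"
  proof (intro eventually_ball_finite ballI eventually_conj)
    have "((\<lambda>t. t * k) \<longlongrightarrow> 0 * k) (at_right 0)" for k :: real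
      by (intro tendsto_intros)
    then have small: "\<forall>\<^sub>F t in at_right 0. t * k < l" if "0 < l" for k l :: real
      using that by (intro order_tendstoD(2)[of _ 0]) auto
    fix b assume "b \<in> arcs G"
    then show "\<forall>\<^sub>F t in at_right 0. t * \<bar>\<theta> b\<bar> < P b / 2"
      "\<forall>\<^sub>F t in at_right 0. t * (\<theta> b)\<^sup>2 < (m - 2 * n) * (P b / 2)"
      using P d by (intro small; simp)+
  qed simp
  then have "\<forall>\<^sub>F t in at_right 0. 0 < t \<and>
      (\<forall>b\<in>arcs G. t * \<bar>\<theta> b\<bar> < P b / 2 \<and> t * (\<theta> b)\<^sup>2 < (m - 2 * n) * (P b / 2))"
    using eventually_at_right_less[of "0 :: real"] by (rule eventually_conj[rotated])
  then obtain t where t: "0 < t" "\<And>b. b \<in> arcs G \<Longrightarrow> t * \<bar>\<theta> b\<bar> < P b / 2"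
    "\<And>b. b \<in> arcs G \<Longrightarrow> t * (\<theta> b)\<^sup>2 < (m - 2 * n) * (P b / 2)"
    using eventually_happens'[OF trivial_limit_at_right_real] by blast
  \<comment> \<open>For \<open>t = 0\<close> this is \<open>x (head G a) / x (tail G a)\<close>, with equality \<open>ev\<close> in all constraints.\<close>
  define \<phi> where "\<phi> a = (P a - t * \<theta> a) / (x (tail G a))\<^sup>2" for a
  have gap: "P b / 2 < P b - t * \<theta> b" if "b \<in> arcs G" for b
  proof -
    have "t * \<theta> b \<le> t * \<bar>\<theta> b\<bar>" using t(1) by (intro mult_left_mono) auto
    then show ?thesis using t(2)[OF that] by linarith
  qed
  have \<phi>_pos: "0 < \<phi> b" if "b \<in> arcs G" for b
    using gap[OF that] P[OF that] x_pos[of "tail G b"] that by (simp add: \<phi>_def)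
  have \<phi>_sum: "(\<Sum>a\<in>out_arcs G v. \<phi> a) = ev - t * m / (x v)\<^sup>2" if v: "v \<in> verts G" for v
  proof -
    have "(\<Sum>a\<in>out_arcs G v. \<phi> a) = (\<Sum>a\<in>out_arcs G v. x v * x (head G a) - t * \<theta> a) / (x v)\<^sup>2"
      unfolding sum_divide_distrib by (intro sum.cong) (auto simp: \<phi>_def P_def)
    also have "(\<Sum>a\<in>out_arcs G v. x v * x (head G a) - t * \<theta> a) = x v * (ev * x v) - t * m"
      using x_eig[OF v] \<theta>_sum[OF v] by (simp add: sum_subtractf sum_distrib_left[symmetric])
    finally show ?thesis using x_pos[OF v] by (simp add: field_simps power2_eq_square)
  qed
  have root_lt: "(\<Sum>a\<in>out_arcs G v. \<phi> a) < ev" if "v \<in> verts G" for v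
    using \<phi>_sum[OF that] t(1) m x_pos[OF that] by simp
  have lt: "1 / \<phi> b + (\<Sum>a\<in>out_arcs G (head G b) - {arev b}. \<phi> a) < ev" if b: "b \<in> arcs G" for b
  proof -
    define u where "u = x (head G b)"
    define w where "w = x (tail G b)"
    define z where "z = t * \<theta> b"
    have uw: "0 < u" "0 < w" using b x_pos by (simp_all add: u_def w_def)
    have Pb: "P b = w * u" by (simp add: P_def u_def w_def)
    have z: "w * u / 2 < w * u - z" using gap[OF b] by (simp add: Pb z_def)
    then have wz: "0 < w * u - z" using uw by (smt (verit) half_gt_zero mult_pos_pos)
    have "z\<^sup>2 / (w * u - z) < t * (m - 2 * n)"
    proof -
      have "z\<^sup>2 = t * (t * (\<theta> b)\<^sup>2)" by (simp add: z_def power2_eq_square)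
      also have "\<dots> < t * ((m - 2 * n) * (w * u / 2))"
        using t(3)[OF b] t(1) unfolding Pb by (rule mult_strict_left_mono)
      also have "\<dots> < t * ((m - 2 * n) * (w * u - z))"
        using z d t(1) by (intro mult_strict_left_mono) auto
      finally show ?thesis using wz by (simp add: pos_divide_less_eq mult.assoc)
    qed
    have arev_b: "\<phi> (arev b) = (w * u - (t * (2 * n) - z)) / u\<^sup>2"
      using b \<theta>_arev[OF b]
      by (simp add: \<phi>_def P_def u_def w_def z_def right_diff_distrib mult.commute)
    \<comment> \<open>Exact first-order expansion of the reciprocal in \<open>z\<close>, with
      remainder \<open>z\<^sup>2 / (w * u - z)\<close>.\<close>
    have inv_b: "1 / \<phi> b = (w * u + z + z\<^sup>2 / (w * u - z)) / u\<^sup>2"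
    proof -
      have "1 / \<phi> b = w\<^sup>2 / (w * u - z)" by (simp add: \<phi>_def P_def u_def w_def z_def)
      also have "\<dots> = (w * u)\<^sup>2 / (w * u - z) / u\<^sup>2" using uw by (simp add: power_mult_distrib)
      also have "(w * u)\<^sup>2 / (w * u - z) = w * u + z + z\<^sup>2 / (w * u - z)"
        using wz by (simp add: field_simps power2_eq_square)
      finally show ?thesis .
    qed
    have "(\<Sum>a\<in>out_arcs G (head G b). \<phi> a) =
        \<phi> (arev b) + (\<Sum>a\<in>out_arcs G (head G b) - {arev b}. \<phi> a)"
      using b by (intro sum.remove) auto
    then have "1 / \<phi> b + (\<Sum>a\<in>out_arcs G (head G b) - {arev b}. \<phi> a) =
        1 / \<phi> b + ev - t * m / u\<^sup>2 - \<phi> (arev b)"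
      using \<phi>_sum[of "head G b"] b by (simp add: u_def)
    \<comment> \<open>The terms \<open>w * u\<close> and \<open>z\<close> cancel between
      \<open>1 / \<phi> b\<close> and \<open>\<phi> (arev b)\<close>, because the sum of
      \<open>\<theta>\<close> over an edge is constant.\<close>
    also have "\<dots> = ev + (z\<^sup>2 / (w * u - z) - t * (m - 2 * n)) / u\<^sup>2"
      unfolding inv_b arev_b by (simp add: diff_divide_distrib add_divide_distrib algebra_simps)
    also have "\<dots> < ev"
      using \<open>z\<^sup>2 / (w * u - z) < t * (m - 2 * n)\<close> uw by (simp add: divide_less_0_iff)
    finally show ?thesis .
  qed
  define W where "W = (\<lambda>v. \<Sum>a\<in>out_arcs G v. \<phi> a) ` verts G \<union>
    (\<lambda>b. 1 / \<phi> b + (\<Sum>a\<in>out_arcs G (head G b) - {arev b}. \<phi> a)) ` arcs G"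
  have "finite W" "W \<noteq> {}" using assms(2) by (auto simp: W_def connected_conv)
  moreover have "\<forall>k\<in>W. k < ev" using root_lt lt by (auto simp: W_def)
  ultimately have "Max W < ev" by simp
  moreover have "(\<Sum>a\<in>out_arcs G v. \<phi> a) \<le> Max W" if "v \<in> verts G" for v
    using \<open>finite W\<close> that by (intro Max_ge) (auto simp: W_def)
  moreover have "1 / \<phi> b + (\<Sum>a\<in>out_arcs G (head G b) - {arev b}. \<phi> a) \<le> Max W" if "b \<in> arcs G" for b
    using \<open>finite W\<close> that by (intro Max_ge) (auto simp: W_def)
  ultimately show ?thesis using \<phi>_pos by (intro exI[of _ \<phi>] exI[of _ "Max W"]) auto
qed

section \<open>The three equivalent conditions\<close>

text \<open>Any arc of the cycle will do; without cycles the claim is vacuous.\<close>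

lemma (in bidirected_digraph) exists_feedback_edge:
  assumes "at_most_one_cycle G arev"
  shows "\<exists>a0. \<forall>q. cycle q \<longrightarrow> (\<forall>a\<in>set q. arev a \<notin> set q) \<longrightarrow> a0 \<in> set q \<or> arev a0 \<in> set q"
proof (cases "\<exists>p. cycle p \<and> (\<forall>a\<in>set p. arev a \<notin> set p)")
  case True
  then obtain p where p: "cycle p" "\<forall>a\<in>set p. arev a \<notin> set p" by blast
  then have "hd p \<in> set p" by (auto simp: cycle_def)
  have "hd p \<in> set q \<or> arev (hd p) \<in> set q" if "cycle q" "\<forall>a\<in>set q. arev a \<notin> set q" for q
  proof -
    have "(\<lambda>a. {a, arev a}) ` set p = (\<lambda>a. {a, arev a}) ` set q"
      using assms p that unfolding at_most_one_cycle_def cycles_def by blast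
    then have "{hd p, arev (hd p)} \<in> (\<lambda>a. {a, arev a}) ` set q" using \<open>hd p \<in> set p\<close> by blast
    then show ?thesis by (auto simp: doubleton_eq_iff)
  qed
  then show ?thesis by blast
qed blast

theorem theorem2:
  fixes G :: "('v, 'e) pre_digraph" and r :: "'e \<Rightarrow> 'e"
    and T :: "('w, 'f) pre_digraph" and s :: "'f \<Rightarrow> 'f"
  assumes "bidirected_digraph G r"
    and "fin_digraph G"
    and "Digraph_Component.connected G"
    and "is_universal_cover T s G r"
  shows "(lambda1 G = rho T \<longleftrightarrow> at_most_one_cycle G r) \<and>
         (at_most_one_cycle G r \<longleftrightarrow> average_degree G \<le> 2)"
proof -
  interpret G: bidirected_digraph G r by fact
  interpret G: fin_digraph G by fact
  obtain \<pi>v \<pi>e where T: "bidirected_digraph T s" "Digraph_Component.connected T" "cycles T s = {}"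
    and \<pi>: "graph_hom T s G r \<pi>v \<pi>e"
      "\<forall>v\<in>verts T. bij_betw \<pi>e (out_arcs T v) (out_arcs G (\<pi>v v))"
    using assms(4) unfolding is_universal_cover_def is_tree_def by blast
  interpret T: bidirected_digraph T s by fact
  obtain root where root: "root \<in> verts T" using T(2) by (auto simp: connected_conv)
  obtain x where x: "\<And>v. v \<in> verts G \<Longrightarrow> 0 < x v"
    "\<And>v. v \<in> verts G \<Longrightarrow> (\<Sum>a\<in>out_arcs G v. x (head G a)) = lambda1 G * x v"
    using G.exists_Perron_eigenvector[OF assms(2,3)] by blast
  interpret C: tree_cover_eigenvector G r T s root \<pi>v \<pi>e x "lambda1 G"
    using T root \<pi> x assms(3) by unfold_locales auto
  have verts: "card (verts G) > 0"
    using assms(3) by (auto simp: connected_conv card_gt_0_iff)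
  \<comment> \<open>There are two arcs per edge, so this compares the number of edges with the
    number of vertices.\<close>
  have avg: "average_degree G \<le> 2 \<longleftrightarrow> card (arcs G) \<le> 2 * card (verts G)"
    using verts by (auto simp: G.average_degree_conv divide_le_eq)
  \<comment> \<open>Three implications in a circle: at most one cycle, equality, average degree at
    most 2, at most one cycle.\<close>
  have "lambda1 G = rho T" if one: "at_most_one_cycle G r"
  proof -
    obtain a0 where "\<And>q. G.cycle q \<Longrightarrow> \<forall>a\<in>set q. r a \<notin> set q \<Longrightarrow> a0 \<in> set q \<or> r a0 \<in> set q"
      using G.exists_feedback_edge[OF one] by blast
    then interpret tree_cover_feedback G r T s root \<pi>v \<pi>e x "lambda1 G" a0
      by unfold_locales
    show ?thesis using C.rho_le_eigenvalue eigenvalue_le_rho by simp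
  qed
  moreover have "average_degree G \<le> 2" if "lambda1 G = rho T"
  proof (rule ccontr)
    assume "\<not> average_degree G \<le> 2"
    then have "2 * card (verts G) < card (arcs G)" using avg by simp
    then obtain \<phi> K where "K < lambda1 G" "\<And>b. b \<in> arcs G \<Longrightarrow> 0 < \<phi> b"
      "\<And>v. v \<in> verts G \<Longrightarrow> (\<Sum>a\<in>out_arcs G v. \<phi> a) \<le> K"
      "\<And>b. b \<in> arcs G \<Longrightarrow> 1 / \<phi> b + (\<Sum>a\<in>out_arcs G (head G b) - {r b}. \<phi> a) \<le> K"
      using G.exists_subcritical_arc_weights[OF assms(2,3) x] by blast
    then have "rho T < lambda1 G" using C.rho_le_if_arc_weights[of \<phi> K] by simp
    then show False using that by simp
  qed
  moreover have "at_most_one_cycle G r" if "average_degree G \<le> 2"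
    using G.card_arcs_ge_if_two_cycles[OF assms(2,3)] that avg by linarith
  ultimately show ?thesis by blast
qed

end
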